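(* Let $\mathcal M$ be a factor von Neumann algebra and $\xi\in\mathbb C$ a nonzero scalar. Let $\delta:\mathcal M\to\mathcal M$ be an additive generalized $\xi$-Lie derivation. (1) If $\xi=1$ and $\deg(\mathcal M)\ge3$, then there exist an additive generalized derivation $\tau:\mathcal M\to\mathcal M$ and an additive functional $h:\mathcal M\to\mathbb C$ with $h([A,B])=0$ for all $A,B\in\mathcal M$, such that $\delta(A)=\tau(A)+h(A)I$ for all $A\in\mathcal M$. (2) If $\xi\ne1$, then $\delta$ is an additive generalized derivation and $\delta(\xi A)=\xi\delta(A)$ for all $A\in\mathcal M$.
   Context: A factor is a von Neumann algebra whose center is $\mathbb C I$, where $I$ is its unit. For $\xi\in\mathbb C$, $[A,B]_\xi=AB-\xi BA$ and $[A,B]=AB-BA$. An additive map $L:\mathcal M\to\mathcal M$ is an additive $\xi$-Lie derivation if $L([A,B]_\xi)=[L(A),B]_\xi+[A,L(B)]_\xi$ for all $A,B\in\mathcal M$. An additive map $\delta:\mathcal M\to\mathcal M$ is an additive generalized $\xi$-Lie derivation if there exists an additive $\xi$-Lie derivation $L:\mathcal M\to\mathcal M$ such that $$\delta([A,B]_\xi)=\delta(A)B-\xi\delta(B)A+AL(B)-\xi BL(A)\quad\text{for all }A,B\in\mathcal M.$$ An additive map $d:\mathcal M\to\mathcal M$ is an additive derivation if $d(AB)=d(A)B+Ad(B)$ for all $A,B\in\mathcal M$; an additive map $\tau:\mathcal M\to\mathcal M$ is an additive generalized derivation if there is an additive derivation $d:\mathcal M\to\mathcal M$ with $\tau(AB)=\tau(A)B+Ad(B)$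 for all $A,B\in\mathcal M$. (Additive maps are not assumed linear.) Degree of algebraicity: with $\mathcal Z(\mathcal M)$ the center of $\mathcal M$, an element $A\in\mathcal M$ is algebraic over $\mathcal Z(\mathcal M)$ if there exist $Z_0,\dots,Z_n\in\mathcal Z(\mathcal M)$ with $Z_n\ne0$ and $Z_0+Z_1A+\cdots+Z_nA^n=0$; the least such $n$ is $\deg(A)$, and $\deg(A)=\infty$ if $A$ is not algebraic. $\deg(\mathcal M)=\sup\{\deg(A):A\in\mathcal M\}$.
   Formalization: In (2), δ(ξA)=ξδ(A) is claimed only if M≠ℂI or ξ is algebraic over ℚ; for M=ℂI and ξ transcendental it is false: take δ=L=D+D(1−ξ)/(1−ξ) with D an additive derivation of ℂ with D(ξ)≠0. *)

theory Defs
  imports "HOL-Analysis.Analysis" "HOL-Library.Extended_Nat" "HOL-Computational_Algebra.Polynomial"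
begin

section \<open>Complex Hilbert spaces\<close>

class complex_vector = real_vector +
  fixes scaleC :: "complex \<Rightarrow> 'a \<Rightarrow> 'a" (infixr "*\<^sub>C" 75)
  assumes scaleC_add_right: "c *\<^sub>C (x + y) = c *\<^sub>C x + c *\<^sub>C y"
    and scaleC_add_left: "(b + c) *\<^sub>C x = b *\<^sub>C x + c *\<^sub>C x"
    and scaleC_scaleC: "b *\<^sub>C c *\<^sub>C x = (b * c) *\<^sub>C x"
    and scaleR_scaleC: "r *\<^sub>R x = complex_of_real r *\<^sub>C x"

class chilbert_space = complex_vector + banach +
  fixes cinner :: "'a \<Rightarrow> 'a \<Rightarrow> complex"
  assumes cinner_commute: "cinner x y = cnj (cinner y x)"
    and cinner_add_left: "cinner (x + y) z = cinner x z + cinner y z"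
    and cinner_scaleC_left: "cinner (c *\<^sub>C x) y = c * cinner x y"
    and norm_eq_sqrt_cinner: "norm x = sqrt (Re (cinner x x))"

lemma scaleC_minus_right: "c *\<^sub>C (- x) = - (c *\<^sub>C x)" for x :: "'a::complex_vector"
proof -
  have "c *\<^sub>C (0::'a) + c *\<^sub>C 0 = c *\<^sub>C 0"
    by (metis add.right_neutral scaleC_add_right)
  then have "c *\<^sub>C (0::'a) = 0" by simp
  then have "c *\<^sub>C x + c *\<^sub>C (- x) = 0"
    by (metis add.right_inverse scaleC_add_right)
  then show ?thesis by (simp add: minus_unique)
qed

lemma scaleC_diff_right: "c *\<^sub>C (x - y) = c *\<^sub>C x - c *\<^sub>C y" for x y :: "'a::complex_vector"
  by (simp only: diff_conv_add_uminus scaleC_add_right scaleC_minus_right)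

lemma scaleC_scaleR: "c *\<^sub>C r *\<^sub>R x = r *\<^sub>R c *\<^sub>C x" for x :: "'a::complex_vector"
  by (simp add: scaleR_scaleC scaleC_scaleC mult.commute)

lemma norm_scaleC: "norm (c *\<^sub>C x) = cmod c * norm x" for x :: "'a::chilbert_space"
proof -
  have "cinner (c *\<^sub>C x) (c *\<^sub>C x) = c * cnj c * cinner x x"
    by (metis cinner_commute cinner_scaleC_left complex_cnj_mult mult.assoc)
  also have "c * cnj c = complex_of_real ((cmod c)\<^sup>2)"
    by (metis complex_norm_square)
  finally have "Re (cinner (c *\<^sub>C x) (c *\<^sub>C x)) = (cmod c)\<^sup>2 * Re (cinner x x)" by simp
  then show ?thesis by (simp add: norm_eq_sqrt_cinner real_sqrt_mult)
qed

lemma bounded_linear_scaleC: "bounded_linear ((*\<^sub>C) c :: 'a \<Rightarrow> 'a::chilbert_space)"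
proof (rule bounded_linear_intro[where K = "cmod c"])
  show "c *\<^sub>C (x + y) = c *\<^sub>C x + c *\<^sub>C y" for x y :: 'a by (rule scaleC_add_right)
  show "c *\<^sub>C r *\<^sub>R x = r *\<^sub>R c *\<^sub>C x" for r and x :: 'a by (rule scaleC_scaleR)
  show "norm (c *\<^sub>C x) \<le> norm x * cmod c" for x :: 'a
    by (simp add: norm_scaleC mult.commute)
qed


section \<open>The algebra of bounded complex-linear operators\<close>

typedef (overloaded) 'h cop =
  "{T :: 'h \<Rightarrow> 'h::chilbert_space. bounded_linear T \<and> (\<forall>c x. T (c *\<^sub>C x) = c *\<^sub>C T x)}"
  morphisms cop_apply Abs_cop
  using bounded_linear_ident by blast

setup_lifting type_definition_cop

text \<open>The class \<open>ring_1\<close> is not available, since it would exclude the zero Hilbert space.\<close>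

instantiation cop :: (chilbert_space) "{ring, monoid_mult, complex_vector}"
begin

lift_definition zero_cop :: "'a cop" is "\<lambda>x. 0"
  by (auto simp: bounded_linear_zero) (metis add.right_neutral add_left_cancel scaleC_add_right)

lift_definition one_cop :: "'a cop" is "\<lambda>x. x"
  by (simp add: bounded_linear_ident)

lift_definition plus_cop :: "'a cop \<Rightarrow> 'a cop \<Rightarrow> 'a cop" is "\<lambda>S T x. S x + T x"
  by (auto simp: bounded_linear_add scaleC_add_right)

lift_definition uminus_cop :: "'a cop \<Rightarrow> 'a cop" is "\<lambda>T x. - T x"
  by (auto simp: bounded_linear_minus scaleC_minus_right)

lift_definition minus_cop :: "'a cop \<Rightarrow> 'a cop \<Rightarrow> 'a cop" is "\<lambda>S T x. S x - T x"
  by (simp add: bounded_linear_sub scaleC_diff_right)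

lift_definition times_cop :: "'a cop \<Rightarrow> 'a cop \<Rightarrow> 'a cop" is "\<lambda>S T x. S (T x)"
  by (auto intro: bounded_linear_compose)

lift_definition scaleC_cop :: "complex \<Rightarrow> 'a cop \<Rightarrow> 'a cop" is "\<lambda>c T x. c *\<^sub>C T x"
  by (auto intro: bounded_linear_compose[OF bounded_linear_scaleC] simp: scaleC_scaleC mult.commute)

lift_definition scaleR_cop :: "real \<Rightarrow> 'a cop \<Rightarrow> 'a cop" is "\<lambda>r T x. r *\<^sub>R T x"
  by (simp add: bounded_linear_const_scaleR scaleC_scaleR)

instance
proof
  fix A B C :: "'a cop" and b c :: complex and r s :: real
  show "A + B + C = A + (B + C)" by transfer (simp add: add.assoc)
  show "A + B = B + A" by transfer (simp add: add.commute)
  show "0 + A = A" by transfer simp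
  show "- A + A = 0" by transfer simp
  show "A - B = A + - B" by transfer simp
  show "A * B * C = A * (B * C)" by transfer simp
  show "(A + B) * C = A * C + B * C" by transfer simp
  show "A * (B + C) = A * B + A * C" by transfer (simp add: linear_simps)
  show "1 * A = A" by transfer simp
  show "A * 1 = A" by transfer simp
  show "r *\<^sub>R (A + B) = r *\<^sub>R A + r *\<^sub>R B" by transfer (simp add: scaleR_add_right)
  show "(r + s) *\<^sub>R A = r *\<^sub>R A + s *\<^sub>R A" by transfer (simp add: scaleR_add_left)
  show "r *\<^sub>R s *\<^sub>R A = (r * s) *\<^sub>R A" by transfer simp
  show "1 *\<^sub>R A = A" by transfer simp
  show "c *\<^sub>C (A + B) = c *\<^sub>C A + c *\<^sub>C B" by transfer (simp add: scaleC_add_right)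
  show "(b + c) *\<^sub>C A = b *\<^sub>C A + c *\<^sub>C A" by transfer (simp add: scaleC_add_left)
  show "b *\<^sub>C c *\<^sub>C A = (b * c) *\<^sub>C A" by transfer (simp add: scaleC_scaleC)
  show "r *\<^sub>R A = complex_of_real r *\<^sub>C A" by transfer (simp add: scaleR_scaleC)
qed

end


section \<open>Von Neumann algebras and factors\<close>

definition is_adjoint :: "'h cop \<Rightarrow> 'h::chilbert_space cop \<Rightarrow> bool" where
  "is_adjoint B A \<longleftrightarrow> (\<forall>x y. cinner (cop_apply A x) y = cinner x (cop_apply B y))"

definition commutant :: "'h::chilbert_space cop set \<Rightarrow> 'h cop set" where
  "commutant S = {B. \<forall>A\<in>S. A * B = B * A}"

text \<open>The Dixmier--Takesaki definition: a self-adjoint set of operators equal to its double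
  commutant. That such a set is a subalgebra containing the identity is automatic, every
  commutant being one.\<close>

definition von_neumann_algebra :: "'h::chilbert_space cop set \<Rightarrow> bool" where
  "von_neumann_algebra M \<longleftrightarrow>
     (\<forall>A\<in>M. \<exists>B\<in>M. is_adjoint B A) \<and> commutant (commutant M) = M"

definition center :: "'h::chilbert_space cop set \<Rightarrow> 'h cop set" where
  "center M = M \<inter> commutant M"

definition scalar_operators :: "'h::chilbert_space cop set" where
  "scalar_operators = range (\<lambda>c. c *\<^sub>C 1)"

definition factor :: "'h::chilbert_space cop set \<Rightarrow> bool" where
  "factor M \<longleftrightarrow> von_neumann_algebra M \<and> center M = scalar_operators"


section \<open>Degree of algebraicity\<close>

text \<open>\<open>Inf {} = \<infinity>\<close> in \<^typ>\<open>enat\<close>, so non-algebraic elements get degree \<open>\<infinity>\<close>.\<close>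

definition alg_degree :: "'h::chilbert_space cop set \<Rightarrow> 'h cop \<Rightarrow> enat" where
  "alg_degree M A = Inf {enat n | n. \<exists>Z. (\<forall>k\<le>n. Z k \<in> center M) \<and> Z n \<noteq> 0 \<and>
                                         (\<Sum>k\<le>n. Z k * A ^ k) = 0}"

definition algebra_degree :: "'h::chilbert_space cop set \<Rightarrow> enat" where
  "algebra_degree M = (SUP A\<in>M. alg_degree M A)"


section \<open>Derivations\<close>

text \<open>Maps on \<open>M\<close> are represented by functions on all operators, of which only the
  restriction to \<open>M\<close> matters.\<close>

definition additive_map_on :: "'h::chilbert_space cop set \<Rightarrow> ('h cop \<Rightarrow> 'h cop) \<Rightarrow> bool" where
  "additive_map_on M F \<longleftrightarrow>
     (\<forall>A\<in>M. F A \<in> M) \<and> (\<forall>A\<in>M. \<forall>B\<in>M. F (A + B) = F A + F B)"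

definition additive_functional_on :: "'h::chilbert_space cop set \<Rightarrow> ('h cop \<Rightarrow> complex) \<Rightarrow> bool" where
  "additive_functional_on M h \<longleftrightarrow> (\<forall>A\<in>M. \<forall>B\<in>M. h (A + B) = h A + h B)"

definition xi_bracket :: "complex \<Rightarrow> 'h cop \<Rightarrow> 'h cop \<Rightarrow> 'h::chilbert_space cop" where
  "xi_bracket \<xi> A B = A * B - \<xi> *\<^sub>C (B * A)"

definition additive_xi_Lie_derivation ::
    "'h::chilbert_space cop set \<Rightarrow> complex \<Rightarrow> ('h cop \<Rightarrow> 'h cop) \<Rightarrow> bool" where
  "additive_xi_Lie_derivation M \<xi> L \<longleftrightarrow> additive_map_on M L \<and>
     (\<forall>A\<in>M. \<forall>B\<in>M. L (xi_bracket \<xi> A B) = xi_bracket \<xi> (L A) B + xi_bracket \<xi> A (L B))"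

definition additive_generalized_xi_Lie_derivation ::
    "'h::chilbert_space cop set \<Rightarrow> complex \<Rightarrow> ('h cop \<Rightarrow> 'h cop) \<Rightarrow> bool" where
  "additive_generalized_xi_Lie_derivation M \<xi> \<delta> \<longleftrightarrow> additive_map_on M \<delta> \<and>
     (\<exists>L. additive_xi_Lie_derivation M \<xi> L \<and>
       (\<forall>A\<in>M. \<forall>B\<in>M. \<delta> (xi_bracket \<xi> A B)
          = \<delta> A * B - \<xi> *\<^sub>C (\<delta> B * A) + A * L B - \<xi> *\<^sub>C (B * L A)))"

definition additive_derivation ::
    "'h::chilbert_space cop set \<Rightarrow> ('h cop \<Rightarrow> 'h cop) \<Rightarrow> bool" where
  "additive_derivation M d \<longleftrightarrow> additive_map_on M d \<and>
     (\<forall>A\<in>M. \<forall>B\<in>M. d (A * B) = d A * B + A * d B)"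

definition additive_generalized_derivation ::
    "'h::chilbert_space cop set \<Rightarrow> ('h cop \<Rightarrow> 'h cop) \<Rightarrow> bool" where
  "additive_generalized_derivation M \<tau> \<longleftrightarrow> additive_map_on M \<tau> \<and>
     (\<exists>d. additive_derivation M d \<and> (\<forall>A\<in>M. \<forall>B\<in>M. \<tau> (A * B) = \<tau> A * B + A * d B))"

end

theory Submission
  imports Defs
begin

text \<open>
  A factor \<open>M\<close> is a prime algebra with trivial extended centroid: for \<open>a, b \<in> M\<close> the projection of
  \<open>H \<times> H\<close> onto the closed span of all \<open>(m a h, m b h)\<close> has central, hence scalar, entries. This
  yields both primeness and the linear dependence of \<open>a\<close> and \<open>b\<close> whenever \<open>a x b = b x a\<close> on \<open>M\<close>;
  the rest is ring theory.

  Testing the defining identity on the unit gives \<open>\<delta> a = L a + (\<delta> 1 - L 1) a\<close>, so only \<open>L\<close> matters.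
  For \<open>\<xi> = - 1\<close> it is a Jordan derivation. For other \<open>\<xi> \<noteq> 1\<close>, \<open>L 1 = l\<close> is a scalar and the
  defect of the derivation identity for \<open>L - l\<close> is a multiple of \<open>l [a, b]\<close>; it is a cocycle, which
  forces \<open>l = 0\<close> unless \<open>M\<close> is commutative.
  For \<open>\<xi> = 1\<close>, the defect \<open>F x y = L (x y) - L x y - x L y\<close> is a symmetric cocycle. If
  \<open>1, t, t\<^sup>2\<close> are independent, the resulting functional identities give \<open>F x t = h (x t) - h x t - h t x\<close>
  for a functional \<open>h\<close>, and then \<open>F x y = h (x y) - h x y - h y x\<close>, so that \<open>L - h\<close> is a derivation.
\<close>

section \<open>Complex scalar multiplication\<close>

lemma scaleC_zero_left: "0 *\<^sub>C x = (0 :: 'a::complex_vector)"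
  by (metis add_cancel_right_left scaleC_add_left)

lemma scaleC_one: "1 *\<^sub>C x = (x :: 'a::complex_vector)"
  using scaleR_scaleC[of 1 x] by simp

lemma scaleC_minus_left: "(- c) *\<^sub>C x = - (c *\<^sub>C x)" for x :: "'a::complex_vector"
  using scaleC_add_left[of c "- c" x] by (simp add: scaleC_zero_left minus_unique)

lemma scaleC_diff_left: "(b - c) *\<^sub>C x = b *\<^sub>C x - c *\<^sub>C x" for x :: "'a::complex_vector"
  using scaleC_add_left[of b "- c" x] by (simp add: scaleC_minus_left)

lemma scaleC_zero_right: "c *\<^sub>C 0 = (0 :: 'a::complex_vector)"
  by (metis add_cancel_right_left scaleC_add_right)

lemma scaleC_eq_0: "c *\<^sub>C x = 0 \<Longrightarrow> c \<noteq> 0 \<Longrightarrow> x = 0" for x :: "'a::complex_vector"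
  by (metis left_inverse scaleC_one scaleC_scaleC scaleC_zero_right)

text \<open>Real scalars exclude 2-torsion. Several identities below arise in doubled form and are
  halved by this.\<close>

lemma add_self_eq_0: "x + x = 0 \<Longrightarrow> x = 0" for x :: "'a::complex_vector"
  by (metis scaleR_2 scaleR_eq_0_iff zero_neq_numeral)


section \<open>Orthogonal projections\<close>

lemma cinner_add_right: "cinner x (y + z) = cinner x y + cinner x z"
  for x :: "'a::chilbert_space"
  by (metis cinner_add_left cinner_commute complex_cnj_add)

lemma cinner_scaleC_right: "cinner x (c *\<^sub>C y) = cnj c * cinner x y"
  for x :: "'a::chilbert_space"
  by (metis cinner_commute cinner_scaleC_left complex_cnj_mult)

lemma cinner_zero_left: "cinner 0 x = 0" for x :: "'a::chilbert_space"
  by (metis add_cancel_right_left cinner_add_left)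

lemma cinner_zero_right: "cinner x 0 = 0" for x :: "'a::chilbert_space"
  by (metis add_cancel_right_left cinner_add_right)

lemma cinner_minus_left: "cinner (- x) y = - cinner x y" for x :: "'a::chilbert_space"
  by (metis add.right_inverse cinner_add_left cinner_zero_left minus_unique)

lemma cinner_minus_right: "cinner x (- y) = - cinner x y" for x :: "'a::chilbert_space"
  by (metis add.right_inverse cinner_add_right cinner_zero_right minus_unique)

lemma cinner_diff_left: "cinner (x - y) z = cinner x z - cinner y z"
  for x :: "'a::chilbert_space"
  using cinner_add_left[of x "- y" z] by (simp add: cinner_minus_left)

lemma cinner_diff_right: "cinner x (y - z) = cinner x y - cinner x z"
  for x :: "'a::chilbert_space"
  using cinner_add_right[of x y "- z"] by (simp add: cinner_minus_right)

lemma cinner_scaleR_left: "cinner (r *\<^sub>R x) y = of_real r * cinner x y"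
  for x :: "'a::chilbert_space"
  by (simp add: scaleR_scaleC cinner_scaleC_left)

lemma cinner_scaleR_right: "cinner x (r *\<^sub>R y) = of_real r * cinner x y"
  for x :: "'a::chilbert_space"
  by (simp add: scaleR_scaleC cinner_scaleC_right)

lemmas cinner_simps = cinner_add_left cinner_add_right cinner_diff_left cinner_diff_right
  cinner_scaleC_left cinner_scaleC_right cinner_scaleR_left cinner_scaleR_right
  cinner_zero_left cinner_zero_right cinner_minus_left cinner_minus_right

lemma norm_power2_cinner: "(norm x)\<^sup>2 = Re (cinner x x)" for x :: "'a::chilbert_space"
proof -
  have "sqrt (Re (cinner x x)) \<ge> 0" by (metis norm_eq_sqrt_cinner norm_ge_zero)
  then show ?thesis by (simp add: norm_eq_sqrt_cinner)
qed

lemma Re_cinner_commute: "Re (cinner x y) = Re (cinner y x)" for x :: "'a::chilbert_space"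
  using cinner_commute[of x y] by simp

lemma cinner_self_eq_0: "cinner x x = 0 \<Longrightarrow> x = 0" for x :: "'a::chilbert_space"
  using norm_power2_cinner[of x] by simp

lemma Re_cinner_polarization:
  "Re (cinner x y) = ((norm (x + y))\<^sup>2 - (norm (x - y))\<^sup>2) / 4" for x :: "'a::chilbert_space"
  by (simp add: norm_power2_cinner cinner_simps Re_cinner_commute[of y x])

lemma Im_cinner: "Im (cinner x y) = Re (cinner x (\<i> *\<^sub>C y))" for x :: "'a::chilbert_space"
  by (simp add: cinner_simps)

text \<open>Polarization expresses both parts of the inner product through norms, so continuity
  follows without the Cauchy-Schwarz inequality.\<close>

lemma continuous_cinner_left: "continuous_on UNIV (\<lambda>x. cinner x y)"
  for y :: "'a::chilbert_space"
proof -
  have "(\<lambda>x. cinner x y) = (\<lambda>x. Complex (((norm (x + y))\<^sup>2 - (norm (x - y))\<^sup>2) / 4)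
      (((norm (x + \<i> *\<^sub>C y))\<^sup>2 - (norm (x - \<i> *\<^sub>C y))\<^sup>2) / 4))"
    by (auto simp: complex_eq_iff Re_cinner_polarization[symmetric] Im_cinner)
  moreover have "continuous_on UNIV \<dots>"
    unfolding Complex_eq by (intro continuous_intros) auto
  ultimately show ?thesis by (simp only:)
qed

lemma closed_orthogonal: "closed {x. cinner x y = 0}" for y :: "'a::chilbert_space"
  using continuous_closed_preimage_constant[OF continuous_cinner_left closed_UNIV, of y 0]
  by simp

text \<open>A minimizing sequence is Cauchy by the parallelogram law, because midpoints of its
  members stay in \<open>K\<close>.\<close>

lemma nearest_point_exists:
  fixes K :: "'a::chilbert_space set"
  assumes "closed K" and "subspace K"
  obtains p where "p \<in> K" and "\<And>k. k \<in> K \<Longrightarrow> norm (x - p) \<le> norm (x - k)"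
proof -
  define D where "D = (\<lambda>k. (norm (x - k))\<^sup>2) ` K"
  define d where "d = Inf D"
  have ne: "D \<noteq> {}" using assms(2) subspace_0 by (auto simp: D_def)
  have bdd: "bdd_below D" by (rule bdd_belowI[of _ 0]) (auto simp: D_def)
  have low: "d \<le> (norm (x - k))\<^sup>2" if "k \<in> K" for k
    unfolding d_def using that bdd by (auto intro!: cInf_lower simp: D_def)
  have "\<exists>k\<in>K. (norm (x - k))\<^sup>2 < d + inverse (Suc n)" for n
    using cInf_lessD[OF ne, of "d + inverse (Suc n)"]
    by (auto simp: d_def[symmetric] simp del: of_nat_Suc) (auto simp: D_def)
  then obtain k where kK: "\<And>n. k n \<in> K"
    and k: "\<And>n. (norm (x - k n))\<^sup>2 < d + inverse (real (Suc n))"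
    by metis
  have gap: "(norm (k m - k n))\<^sup>2 \<le> 2 * inverse (real (Suc m)) + 2 * inverse (real (Suc n))" for m n
  proof -
    have "(1/2) *\<^sub>R (k m + k n) \<in> K"
      using assms(2) kK by (simp add: subspace_add subspace_scale)
    then have "d \<le> (norm (x - (1/2) *\<^sub>R (k m + k n)))\<^sup>2" by (rule low)
    \<comment> \<open>Parallelogram law for \<open>x - k m\<close> and \<open>x - k n\<close>, whose
      half sum is \<open>x\<close> minus the midpoint.\<close>
    moreover have "(norm (k m - k n))\<^sup>2 = 2 * (norm (x - k m))\<^sup>2 + 2 * (norm (x - k n))\<^sup>2
        - 4 * (norm (x - (1/2) *\<^sub>R (k m + k n)))\<^sup>2"
      by (simp add: norm_power2_cinner cinner_simps Re_cinner_commute[of "k n" "k m"]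
          Re_cinner_commute[of "k n" x] Re_cinner_commute[of "k m" x] field_simps)
    ultimately show ?thesis using k[of m] k[of n] by linarith
  qed
  have "Cauchy k"
  proof (rule CauchyI)
    fix e :: real assume e: "e > 0"
    then obtain N where N: "inverse (real (Suc N)) < e\<^sup>2 / 4"
      using reals_Archimedean[of "e\<^sup>2 / 4"] by auto
    have "norm (k m - k n) < e" if "m \<ge> N" "n \<ge> N" for m n
    proof -
      have "inverse (real (Suc m)) \<le> inverse (real (Suc N))"
        "inverse (real (Suc n)) \<le> inverse (real (Suc N))"
        using that by (auto intro!: le_imp_inverse_le)
      then have "(norm (k m - k n))\<^sup>2 < e\<^sup>2" using gap[of m n] N by linarith
      then show ?thesis using e by (simp add: power2_less_imp_less)
    qed
    then show "\<exists>N. \<forall>m\<ge>N. \<forall>n\<ge>N. norm (k m - k n) < e" by blast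
  qed
  then obtain p where lim: "k \<longlonglongrightarrow> p" by (auto simp: Cauchy_convergent_iff convergent_def)
  have pK: "p \<in> K" using closed_sequentially[OF assms(1)] kK lim by blast
  have "(\<lambda>n. (norm (x - k n))\<^sup>2) \<longlonglongrightarrow> (norm (x - p))\<^sup>2"
    by (intro tendsto_intros lim)
  moreover have "(\<lambda>n. d + inverse (real (Suc n))) \<longlonglongrightarrow> d + 0"
    by (intro tendsto_intros LIMSEQ_inverse_real_of_nat)
  ultimately have le: "(norm (x - p))\<^sup>2 \<le> d + 0"
    using k by (intro LIMSEQ_le[of _ _ "\<lambda>n. d + inverse (real (Suc n))"]) (auto intro: less_imp_le)
  have "norm (x - p) \<le> norm (x - y)" if "y \<in> K" for y
  proof (rule power2_le_imp_le)
    show "(norm (x - p))\<^sup>2 \<le> (norm (x - y))\<^sup>2"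
      using low[OF that] le by linarith
  qed simp
  then show ?thesis using that pK by blast
qed

text \<open>Varying the nearest point along \<open>k\<close> shows that the real part of the inner
  product vanishes; the same for \<open>\<i> *\<^sub>C k\<close> handles the imaginary part.\<close>

lemma orthogonal_decomposition:
  fixes K :: "'a::chilbert_space set"
  assumes "closed K" and "subspace K" and iK: "\<And>k. k \<in> K \<Longrightarrow> \<i> *\<^sub>C k \<in> K"
  obtains p where "p \<in> K" and "\<And>k. k \<in> K \<Longrightarrow> cinner k (x - p) = 0"
proof -
  obtain p where p: "p \<in> K" and near: "\<And>k. k \<in> K \<Longrightarrow> norm (x - p) \<le> norm (x - k)"
    using nearest_point_exists[OF assms(1,2)] by metis
  have Re0: "Re (cinner k (x - p)) = 0" if k: "k \<in> K" for k
  proof -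
    define c where "c = Re (cinner k (x - p))"
    define n where "n = (norm k)\<^sup>2"
    \<comment> \<open>This choice turns \<open>2 * s * c \<le> s\<^sup>2 * n\<close> into
      \<open>c\<^sup>2 * (n + 2) \<le> 0\<close>; the added 1 keeps the denominator positive when
      \<open>k = 0\<close>.\<close>
    define s where "s = c / (n + 1)"
    have n: "n \<ge> 0" by (simp add: n_def)
    have "p + s *\<^sub>R k \<in> K" using assms(2) p k by (simp add: subspace_add subspace_scale)
    then have "(norm (x - p))\<^sup>2 \<le> (norm (x - (p + s *\<^sub>R k)))\<^sup>2"
      using near by (simp add: power_mono)
    also have "\<dots> = (norm ((x - p) - s *\<^sub>R k))\<^sup>2" by (simp add: algebra_simps)
    also have "\<dots> = (norm (x - p))\<^sup>2 - 2 * s * c + s\<^sup>2 * n"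
      using Re_cinner_commute[of "x - p" k] unfolding c_def n_def
      by (simp only: norm_power2_cinner cinner_diff_left[of "x - p"] cinner_diff_right[of _ "x - p"]
          cinner_scaleR_left cinner_scaleR_right) (simp add: power2_eq_square algebra_simps)
    finally have "2 * s * c \<le> s\<^sup>2 * n" by simp
    then have "2 * s * c * (n + 1)\<^sup>2 \<le> s\<^sup>2 * n * (n + 1)\<^sup>2" by (rule mult_right_mono) simp
    moreover have "s * (n + 1) = c" using n by (simp add: s_def)
    ultimately have "2 * c\<^sup>2 * (n + 1) \<le> c\<^sup>2 * n"
      by (metis (no_types, lifting) ab_semigroup_mult_class.mult_ac(1) mult.commute power2_eq_square)
    then have "c\<^sup>2 * (n + 2) \<le> 0" by (simp add: algebra_simps)
    then have "c\<^sup>2 = 0" using n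
      by (metis add_nonneg_pos mult_le_0_iff not_less power2_less_eq_zero_iff zero_less_numeral power_eq_0_iff)
    then show ?thesis by (simp add: c_def)
  qed
  have "cinner k (x - p) = 0" if k: "k \<in> K" for k
    using Re0[OF k] Re0[OF iK[OF k]] by (simp add: complex_eq_iff cinner_scaleC_left)
  then show ?thesis using that p by blast
qed

lemma cop_apply_add: "cop_apply T (x + y) = cop_apply T x + cop_apply T y"
  using cop_apply[of T] by (auto simp: linear_simps)

lemma cop_apply_scaleC: "cop_apply T (c *\<^sub>C x) = c *\<^sub>C cop_apply T x"
  using cop_apply[of T] by auto

lemma cop_apply_diff: "cop_apply T (x - y) = cop_apply T x - cop_apply T y"
  using cop_apply[of T] by (auto simp: linear_simps)

lemma cop_apply_zero: "cop_apply T 0 = 0"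
  using cop_apply[of T] by (auto simp: linear_simps)

lemma bounded_linear_cop_apply: "bounded_linear (cop_apply T)"
  using cop_apply[of T] by auto

lemma orthogonal_projection_unique:
  fixes K :: "'a::chilbert_space set"
  assumes "subspace K" and "p \<in> K" and "p' \<in> K"
    and p: "\<And>k. k \<in> K \<Longrightarrow> cinner k (x - p) = 0" and p': "\<And>k. k \<in> K \<Longrightarrow> cinner k (x - p') = 0"
  shows "p = p'"
proof -
  have d: "p - p' \<in> K" using assms(1-3) by (simp add: subspace_diff)
  have "cinner (p - p') (p - p') = cinner (p - p') (x - p') - cinner (p - p') (x - p)"
    by (simp add: cinner_simps)
  also have "\<dots> = 0" using p[OF d] p'[OF d] by simp
  finally show ?thesis using cinner_self_eq_0 by fastforce
qed

text \<open>By uniqueness, linearity only requires checking that the candidate value has the two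
  defining properties. Pythagoras gives the norm bound 1.\<close>

lemma orthogonal_projection_exists:
  fixes K :: "'a::chilbert_space set"
  assumes "closed K" and "subspace K" and cK: "\<And>c k. k \<in> K \<Longrightarrow> c *\<^sub>C k \<in> K"
  obtains P :: "'a cop" where "\<And>x. cop_apply P x \<in> K"
    and "\<And>x k. k \<in> K \<Longrightarrow> cinner k (x - cop_apply P x) = 0"
proof -
  have "\<forall>x. \<exists>p. p \<in> K \<and> (\<forall>k\<in>K. cinner k (x - p) = 0)"
    using orthogonal_decomposition[OF assms(1,2) cK] by metis
  then obtain P where PK: "\<And>x. P x \<in> K" and P: "\<And>x k. k \<in> K \<Longrightarrow> cinner k (x - P x) = 0"
    by metis
  have uniq: "P x = p" if "p \<in> K" "\<And>k. k \<in> K \<Longrightarrow> cinner k (x - p) = 0" for x p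
    by (rule orthogonal_projection_unique[OF assms(2) PK that(1) P that(2)])
  have add: "P (x + y) = P x + P y" for x y
  proof (rule uniq)
    show "P x + P y \<in> K" using PK assms(2) by (simp add: subspace_add)
    fix k assume k: "k \<in> K"
    have "x + y - (P x + P y) = (x - P x) + (y - P y)" by simp
    then show "cinner k (x + y - (P x + P y)) = 0" using P[OF k] by (simp only: cinner_add_right) simp
  qed
  have scale: "P (c *\<^sub>C x) = c *\<^sub>C P x" for c x
  proof (rule uniq)
    show "c *\<^sub>C P x \<in> K" using PK cK by simp
    fix k assume k: "k \<in> K"
    show "cinner k (c *\<^sub>C x - c *\<^sub>C P x) = 0"
      using P[OF k, of x] by (simp add: scaleC_diff_right[symmetric] cinner_scaleC_right)
  qed
  have bound: "norm (P x) \<le> norm x" for x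
  proof -
    have 0: "cinner (P x) (x - P x) = 0" using P PK by blast
    have "(norm x)\<^sup>2 = (norm (P x + (x - P x)))\<^sup>2" by simp
    also have "\<dots> = (norm (P x))\<^sup>2 + (norm (x - P x))\<^sup>2"
      using 0 Re_cinner_commute[of "x - P x" "P x"]
      by (simp only: norm_power2_cinner cinner_add_left[of "P x"] cinner_add_right[of _ "P x"]) simp
    finally have "(norm (P x))\<^sup>2 \<le> (norm x)\<^sup>2" by simp
    then show ?thesis by (rule power2_le_imp_le) simp
  qed
  have "bounded_linear P"
    using add scale bound by (intro bounded_linear_intro[where K = 1]) (auto simp: scaleR_scaleC)
  then have "cop_apply (Abs_cop P) = P" using scale by (simp add: Abs_cop_inverse)
  then show ?thesis using that[of "Abs_cop P"] PK P by simp
qed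

section \<open>Direct sums of two Hilbert spaces\<close>

instantiation prod :: (complex_vector, complex_vector) complex_vector
begin

definition scaleC_prod :: "complex \<Rightarrow> 'a \<times> 'b \<Rightarrow> 'a \<times> 'b" where
  "c *\<^sub>C x = (c *\<^sub>C fst x, c *\<^sub>C snd x)"

instance
  by standard (simp_all add: scaleC_prod_def scaleC_add_right scaleC_add_left scaleC_scaleC
      scaleR_scaleC scaleR_prod_def)

end

instantiation prod :: (chilbert_space, chilbert_space) chilbert_space
begin

definition cinner_prod :: "'a \<times> 'b \<Rightarrow> 'a \<times> 'b \<Rightarrow> complex" where
  "cinner x y = cinner (fst x) (fst y) + cinner (snd x) (snd y)"

instance
proof
  fix x y z :: "'a \<times> 'b" and c :: complex
  show "cinner x y = cnj (cinner y x)"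
    using cinner_commute[of "fst x" "fst y"] cinner_commute[of "snd x" "snd y"]
    by (simp add: cinner_prod_def)
  show "cinner (x + y) z = cinner x z + cinner y z"
    by (simp add: cinner_prod_def cinner_add_left)
  show "cinner (c *\<^sub>C x) y = c * cinner x y"
    by (simp add: cinner_prod_def scaleC_prod_def cinner_scaleC_left algebra_simps)
  show "norm x = sqrt (Re (cinner x x))"
    by (simp add: cinner_prod_def norm_prod_def norm_power2_cinner)
qed

end


section \<open>Primeness and extended centroid of factors\<close>

lemma cop_eqI: "(\<And>x. cop_apply A x = cop_apply B x) \<Longrightarrow> A = B"
  by (metis cop_apply_inject ext)

lemma cop_apply_mult: "cop_apply (A * B) x = cop_apply A (cop_apply B x)"
  by transfer simp

lemma cop_mult_scaleC_left: "(c *\<^sub>C A) * B = c *\<^sub>C (A * B)" for A B :: "'h::chilbert_space cop"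
  by transfer simp

lemma cop_mult_scaleC_right: "A * (c *\<^sub>C B) = c *\<^sub>C (A * B)" for A B :: "'h::chilbert_space cop"
  by transfer auto

lemma commutantD: "B \<in> commutant S \<Longrightarrow> A \<in> S \<Longrightarrow> A * B = B * A"
  by (simp add: commutant_def)

lemma commutant_one: "1 \<in> commutant S"
  by (simp add: commutant_def)

lemma commutant_add: "A \<in> commutant S \<Longrightarrow> B \<in> commutant S \<Longrightarrow> A + B \<in> commutant S"
  by (simp add: commutant_def algebra_simps)

lemma commutant_mult: "A \<in> commutant S \<Longrightarrow> B \<in> commutant S \<Longrightarrow> A * B \<in> commutant S"
  unfolding commutant_def by (auto simp: mult.assoc) (metis mult.assoc)

lemma commutant_scaleC: "A \<in> commutant S \<Longrightarrow> c *\<^sub>C A \<in> commutant S"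
  by (simp add: commutant_def cop_mult_scaleC_left cop_mult_scaleC_right)

lemma factor_bicommutant: "factor M \<Longrightarrow> commutant (commutant M) = M"
  by (simp add: factor_def von_neumann_algebra_def)

lemma factor_closed:
  assumes "factor M"
  shows "1 \<in> M" and "A \<in> M \<Longrightarrow> B \<in> M \<Longrightarrow> A + B \<in> M"
    and "A \<in> M \<Longrightarrow> B \<in> M \<Longrightarrow> A * B \<in> M" and "A \<in> M \<Longrightarrow> c *\<^sub>C A \<in> M"
  using commutant_one[of "commutant M"] commutant_add[of A "commutant M" B]
    commutant_mult[of A "commutant M" B] commutant_scaleC[of A "commutant M" c]
  by (simp_all add: factor_bicommutant[OF assms])

lemma factor_central_scalar:
  assumes "factor M" and "A \<in> M" and "\<And>B. B \<in> M \<Longrightarrow> A * B = B * A"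
  obtains c where "A = c *\<^sub>C 1"
proof -
  have "A \<in> center M" using assms(2,3) by (simp add: center_def commutant_def)
  then show ?thesis using assms(1) that by (auto simp: factor_def scalar_operators_def)
qed

lemma factor_adjoint: "factor M \<Longrightarrow> A \<in> M \<Longrightarrow> \<exists>B\<in>M. is_adjoint B A"
  by (simp add: factor_def von_neumann_algebra_def)

lemma subspace_closure:
  fixes S :: "'a::real_normed_vector set"
  assumes "subspace S"
  shows "subspace (closure S)"
  unfolding subspace_def
proof (intro conjI ballI allI)
  show "0 \<in> closure S" using assms by (meson closure_subset subsetD subspace_0)
  show "x + y \<in> closure S" if xy: "x \<in> closure S" "y \<in> closure S" for x y
  proof -
    from xy obtain f g where "\<forall>n. f n \<in> S" "f \<longlonglongrightarrow> x" "\<forall>n. g n \<in> S" "g \<longlonglongrightarrow> y"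
      unfolding closure_sequential by blast
    then show ?thesis unfolding closure_sequential
      using assms by (intro exI[of _ "\<lambda>n. f n + g n"]) (auto simp: subspace_add intro: tendsto_add)
  qed
  show "c *\<^sub>R x \<in> closure S" if x: "x \<in> closure S" for c x
  proof -
    from x obtain f where "\<forall>n. f n \<in> S" "f \<longlonglongrightarrow> x"
      unfolding closure_sequential by blast
    then show ?thesis unfolding closure_sequential
      using assms by (intro exI[of _ "\<lambda>n. c *\<^sub>R f n"]) (auto simp: subspace_scale intro: tendsto_scaleR)
  qed
qed

lemma closure_span_image:
  assumes "bounded_linear f" and "\<And>s. s \<in> S \<Longrightarrow> f s \<in> span S" and "x \<in> closure (span S)"
  shows "f x \<in> closure (span S)"
proof -
  have "f ` span S = span (f ` S)"
    using assms(1) by (simp add: linear_span_image bounded_linear.linear)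
  also have "\<dots> \<subseteq> span S" using assms(2) by (intro span_minimal) auto
  finally have "closure (f ` span S) \<subseteq> closure (span S)" by (rule closure_mono)
  then show ?thesis
    using closure_bounded_linear_image_subset[OF assms(1), of "span S"] assms(3) by blast
qed

lemma orthogonal_closure_span:
  fixes y :: "'a::chilbert_space"
  assumes "\<And>s. s \<in> S \<Longrightarrow> cinner s y = 0" and "x \<in> closure (span S)"
  shows "cinner x y = 0"
proof -
  have "subspace {x. cinner x y = 0}"
    by (auto simp: subspace_def cinner_simps)
  then have "span S \<subseteq> {x. cinner x y = 0}" using assms(1) by (intro span_minimal) auto
  then show ?thesis using closure_minimal[OF _ closed_orthogonal] assms(2) by blast
qed

text \<open>The closed subspace \<open>closure (span S)\<close> of \<open>H \<times> H\<close> is invariant, together with its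
  orthogonal complement, under the diagonal action of \<open>M\<close> and of its commutant. The four
  entries of the orthogonal projection onto it are therefore central.\<close>

lemma factor_pair_projection:
  fixes M :: "'h::chilbert_space cop set"
  assumes M: "factor M" and a: "a \<in> M" and b: "b \<in> M"
  defines "S \<equiv> {(cop_apply (m * a) h, cop_apply (m * b) h) | m h. m \<in> M}"
  obtains c11 c12 c21 c22 where
    "\<And>x y. (c11 *\<^sub>C x + c12 *\<^sub>C y, c21 *\<^sub>C x + c22 *\<^sub>C y) \<in> closure (span S)"
    and "a = c11 *\<^sub>C a + c12 *\<^sub>C b" and "b = c21 *\<^sub>C a + c22 *\<^sub>C b"
proof -
  define K where "K = closure (span S)"
  define diag where "diag T p = (cop_apply T (fst p), cop_apply T (snd p))" for T :: "'h cop" and p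
  have diag_bl: "bounded_linear (diag T)" for T
    unfolding diag_def
    by (intro bounded_linear_Pair bounded_linear_compose[OF bounded_linear_cop_apply]
        bounded_linear_fst bounded_linear_snd)
  have S_K: "s \<in> S \<Longrightarrow> s \<in> K" for s
    unfolding K_def by (meson closure_subset span_base subsetD)
  have sub: "subspace K" unfolding K_def by (intro subspace_closure subspace_span)
  \<comment> \<open>An operator of \<open>M\<close> is absorbed into \<open>m\<close>; one of the
    commutant passes through \<open>m * a\<close> and \<open>m * b\<close> and is absorbed into the
    vector \<open>h\<close>.\<close>
  have diag_S: "diag T s \<in> span S" if "T \<in> M \<or> T \<in> commutant M" and "s \<in> S" for T s
  proof -
    from that(2) obtain m h where m: "m \<in> M"
      and s: "s = (cop_apply (m * a) h, cop_apply (m * b) h)" by (auto simp: S_def)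
    have "diag T s \<in> S" using that(1)
    proof
      assume "T \<in> M"
      then have "T * m \<in> M" using factor_closed(3)[OF M] m by blast
      moreover have "diag T s = (cop_apply ((T * m) * a) h, cop_apply ((T * m) * b) h)"
        by (simp add: s diag_def cop_apply_mult)
      ultimately show ?thesis unfolding S_def by blast
    next
      assume T: "T \<in> commutant M"
      have "T * (m * x) = (m * x) * T" if "x \<in> M" for x
        using commutantD[OF T factor_closed(3)[OF M m that]] by simp
      then have "diag T s = (cop_apply (m * a) (cop_apply T h), cop_apply (m * b) (cop_apply T h))"
        using a b unfolding s diag_def fst_conv snd_conv cop_apply_mult[symmetric] by simp
      then show ?thesis using m unfolding S_def by blast
    qed
    then show ?thesis by (rule span_base)
  qed
  then have diag_K: "diag T k \<in> K" if "T \<in> M \<or> T \<in> commutant M" and "k \<in> K" for T k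
    using closure_span_image[OF diag_bl] that unfolding K_def by blast
  have "c *\<^sub>C s \<in> span S" if "s \<in> S" for c s
  proof -
    have "c *\<^sub>C s \<in> S" using that
      by (auto simp: S_def scaleC_prod_def) (metis cop_apply_scaleC)
    then show ?thesis by (rule span_base)
  qed
  then have cK: "c *\<^sub>C k \<in> K" if "k \<in> K" for c k
    using closure_span_image[OF bounded_linear_scaleC] that unfolding K_def by blast
  have perp_iff: "(\<forall>k\<in>K. cinner k y = 0) \<longleftrightarrow>
      (\<forall>m\<in>M. \<forall>h. cinner (cop_apply (m * a) h) (fst y) + cinner (cop_apply (m * b) h) (snd y) = 0)"
    (is "?perp y \<longleftrightarrow> ?rel y") for y
  proof
    assume p: "?perp y"
    show "?rel y"
    proof (intro ballI allI)
      fix m h assume "m \<in> M"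
      then have "(cop_apply (m * a) h, cop_apply (m * b) h) \<in> S" unfolding S_def by blast
      then show "cinner (cop_apply (m * a) h) (fst y) + cinner (cop_apply (m * b) h) (snd y) = 0"
        using p S_K by (fastforce simp: cinner_prod_def)
    qed
  next
    assume "?rel y"
    then have "cinner s y = 0" if "s \<in> S" for s
      using that by (auto simp: S_def cinner_prod_def)
    then show "?perp y" unfolding K_def using orthogonal_closure_span by blast
  qed
  have diag_perp: "\<forall>k\<in>K. cinner k (diag T y) = 0"
    if T: "T \<in> M \<or> T \<in> commutant M" and y: "\<forall>k\<in>K. cinner k y = 0" for T y
    unfolding perp_iff
  proof (intro ballI allI)
    fix m h assume m: "m \<in> M"
    have rel: "cinner (cop_apply (m * a) h) (fst y) + cinner (cop_apply (m * b) h) (snd y) = 0"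
      if "m \<in> M" for m h using y that unfolding perp_iff by blast
    from T show "cinner (cop_apply (m * a) h) (fst (diag T y))
        + cinner (cop_apply (m * b) h) (snd (diag T y)) = 0"
    proof
      assume "T \<in> M"
      then obtain T' where T': "T' \<in> M" "is_adjoint T' T" using factor_adjoint[OF M] by blast
      have "cinner x (cop_apply T y) = cinner (cop_apply T' x) y" for x y
        using T'(2) unfolding is_adjoint_def by (metis cinner_commute)
      then show ?thesis using rel[OF factor_closed(3)[OF M T'(1) m], of h]
        by (simp add: diag_def cop_apply_mult)
    next
      assume T: "T \<in> commutant M"
      obtain A where A: "A \<in> M" "is_adjoint A (m * a)"
        using factor_adjoint[OF M] factor_closed(3)[OF M m a] by blast
      obtain B where B: "B \<in> M" "is_adjoint B (m * b)"
        using factor_adjoint[OF M] factor_closed(3)[OF M m b] by blast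
      \<comment> \<open>The relation holds for every vector, so it becomes one equation between
        vectors. The adjoints \<open>A\<close> and \<open>B\<close> in it lie in \<open>M\<close>
        and commute with \<open>T\<close>.\<close>
      have "cinner z (cop_apply A (fst y) + cop_apply B (snd y)) = 0" for z
        using rel[OF m, of z] A(2) B(2) by (simp add: is_adjoint_def cinner_add_right)
      then have "cop_apply A (fst y) + cop_apply B (snd y) = 0" using cinner_self_eq_0 by blast
      then have "cop_apply T (cop_apply A (fst y)) + cop_apply T (cop_apply B (snd y)) = 0"
        by (metis cop_apply_add cop_apply_zero)
      then have "cop_apply A (cop_apply T (fst y)) + cop_apply B (cop_apply T (snd y)) = 0"
        using commutantD[OF T A(1)] commutantD[OF T B(1)] by (simp add: cop_apply_mult[symmetric])
      then show ?thesis using A(2) B(2)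
        by (simp add: is_adjoint_def diag_def cinner_add_right[symmetric] cinner_zero_right)
    qed
  qed
  obtain P where PK: "\<And>x. cop_apply P x \<in> K"
    and P: "\<And>x k. k \<in> K \<Longrightarrow> cinner k (x - cop_apply P x) = 0"
    using orthogonal_projection_exists[of K] sub cK by (auto simp: K_def)
  have P_uniq: "cop_apply P x = p" if "p \<in> K" "\<And>k. k \<in> K \<Longrightarrow> cinner k (x - p) = 0" for x p
    by (rule orthogonal_projection_unique[OF sub PK that(1) P that(2)])
  have P_diag: "cop_apply P (diag T x) = diag T (cop_apply P x)"
    if "T \<in> M \<or> T \<in> commutant M" for T x
  proof (rule P_uniq)
    show "diag T (cop_apply P x) \<in> K" using diag_K that PK by blast
    fix k assume k: "k \<in> K"
    have "cinner k (diag T (x - cop_apply P x)) = 0"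
      using diag_perp[OF that, of "x - cop_apply P x"] P k by blast
    then show "cinner k (diag T x - diag T (cop_apply P x)) = 0"
      by (simp add: diag_def cop_apply_diff)
  qed
  \<comment> \<open>\<open>J\<close> and \<open>pr\<close> stand for the inclusions and the
    coordinate maps of \<open>H \<times> H\<close>. The compression of \<open>P\<close> commutes
    with \<open>M\<close> and with its commutant, hence is central.\<close>
  have entry: "\<exists>c. \<forall>x. pr (cop_apply P (J x)) = c *\<^sub>C x"
    if J: "bounded_linear J" "\<And>c x. J (c *\<^sub>C x) = c *\<^sub>C J x" "\<And>T x. J (cop_apply T x) = diag T (J x)"
      and pr: "bounded_linear pr" "\<And>c x. pr (c *\<^sub>C x) = c *\<^sub>C pr x"
      "\<And>T x. pr (diag T x) = cop_apply T (pr x)"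
    for J :: "'h \<Rightarrow> 'h \<times> 'h" and pr :: "'h \<times> 'h \<Rightarrow> 'h"
  proof -
    define W where "W = Abs_cop (\<lambda>x. pr (cop_apply P (J x)))"
    have W: "cop_apply W x = pr (cop_apply P (J x))" for x
      unfolding W_def using J pr
      by (subst Abs_cop_inverse) (auto intro!: bounded_linear_compose[OF pr(1)]
          bounded_linear_compose[OF bounded_linear_cop_apply] simp: cop_apply_scaleC)
    have comm: "T * W = W * T" if "T \<in> M \<or> T \<in> commutant M" for T
      by (rule cop_eqI) (simp add: cop_apply_mult W J(3) P_diag[OF that] pr(3))
    then have "W \<in> commutant (commutant M)" and "W \<in> commutant M"
      by (auto simp: commutant_def)
    then have "W \<in> M" and "W \<in> commutant M" by (auto simp: factor_bicommutant[OF M])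
    then obtain c where "W = c *\<^sub>C 1"
      using factor_central_scalar[OF M] commutantD by metis
    then have "pr (cop_apply P (J x)) = c *\<^sub>C x" for x
      using W by (simp add: scaleC_cop.rep_eq one_cop.rep_eq)
    then show ?thesis by blast
  qed
  have inl: "bounded_linear (\<lambda>x::'h. (x, 0::'h))" "bounded_linear (\<lambda>x::'h. (0::'h, x))"
    by (intro bounded_linear_Pair bounded_linear_ident bounded_linear_zero)+
  note simps = scaleC_prod_def scaleC_zero_right diag_def cop_apply_zero bounded_linear_fst bounded_linear_snd
  obtain c11 where c11: "\<And>x. fst (cop_apply P (x, 0)) = c11 *\<^sub>C x"
    using entry[of "\<lambda>x. (x, 0)" fst] inl by (auto simp: simps)
  obtain c12 where c12: "\<And>x. fst (cop_apply P (0, x)) = c12 *\<^sub>C x"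
    using entry[of "\<lambda>x. (0, x)" fst] inl by (auto simp: simps)
  obtain c21 where c21: "\<And>x. snd (cop_apply P (x, 0)) = c21 *\<^sub>C x"
    using entry[of "\<lambda>x. (x, 0)" snd] inl by (auto simp: simps)
  obtain c22 where c22: "\<And>x. snd (cop_apply P (0, x)) = c22 *\<^sub>C x"
    using entry[of "\<lambda>x. (0, x)" snd] inl by (auto simp: simps)
  have P_eq: "cop_apply P (x, y) = (c11 *\<^sub>C x + c12 *\<^sub>C y, c21 *\<^sub>C x + c22 *\<^sub>C y)" for x y
  proof -
    have "cop_apply P (x, y) = cop_apply P (x, 0) + cop_apply P (0, y)"
      by (simp add: cop_apply_add[symmetric])
    then show ?thesis by (simp add: prod_eq_iff c11 c12 c21 c22)
  qed
  \<comment> \<open>For \<open>m = 1\<close> the pair of images of \<open>h\<close> lies in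
    \<open>K\<close>, where \<open>P\<close> is the identity. This yields the two equations for
    \<open>a\<close> and \<open>b\<close>.\<close>
  have fixed: "(cop_apply a h, cop_apply b h) = (c11 *\<^sub>C cop_apply a h + c12 *\<^sub>C cop_apply b h,
      c21 *\<^sub>C cop_apply a h + c22 *\<^sub>C cop_apply b h)" for h
  proof -
    have "(cop_apply (1 * a) h, cop_apply (1 * b) h) \<in> S"
      using factor_closed(1)[OF M] unfolding S_def by blast
    then have "(cop_apply a h, cop_apply b h) \<in> K" using S_K by simp
    then have "cop_apply P (cop_apply a h, cop_apply b h) = (cop_apply a h, cop_apply b h)"
      by (intro P_uniq) (auto simp: cinner_zero_right zero_prod_def[symmetric])
    then show ?thesis by (simp add: P_eq)
  qed
  show ?thesis
  proof (rule that)
    show "(c11 *\<^sub>C x + c12 *\<^sub>C y, c21 *\<^sub>C x + c22 *\<^sub>C y) \<in> closure (span S)" for x y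
      using PK[of "(x, y)"] by (simp add: P_eq K_def)
    show "a = c11 *\<^sub>C a + c12 *\<^sub>C b"
      by (rule cop_eqI) (use fixed in \<open>simp add: plus_cop.rep_eq scaleC_cop.rep_eq\<close>)
    show "b = c21 *\<^sub>C a + c22 *\<^sub>C b"
      by (rule cop_eqI) (use fixed in \<open>simp add: plus_cop.rep_eq scaleC_cop.rep_eq\<close>)
  qed
qed

lemma closure_span_kernel:
  assumes "bounded_linear f" and "\<And>s. s \<in> S \<Longrightarrow> f s = 0" and "x \<in> closure (span S)"
  shows "f x = 0"
proof -
  have "continuous_on UNIV f" using assms(1) by (simp add: linear_continuous_on)
  then have "closed {x. f x = 0}"
    using continuous_closed_preimage_constant[of UNIV f 0] by simp
  moreover have "span S \<subseteq> {x. f x = 0}"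
    using assms(1,2) by (intro span_minimal linear_subspace_kernel bounded_linear.linear) auto
  ultimately show ?thesis using closure_minimal assms(3) by blast
qed

text \<open>For the pair \<open>b, 0\<close> the equation for \<open>b\<close> forces
  \<open>c11 = 1\<close>, so the first coordinates of the closed span fill the whole space. But
  \<open>a\<close> annihilates the first coordinates of all generators.\<close>

lemma factor_prime:
  assumes M: "factor M" and a: "a \<in> M" and b: "b \<in> M"
    and ab: "\<And>m. m \<in> M \<Longrightarrow> a * m * b = 0" and "b \<noteq> 0"
  shows "a = 0"
proof -
  have z: "0 \<in> M"
    using factor_closed(4)[OF M factor_closed(1)[OF M], of 0] by (simp add: scaleC_zero_left)
  obtain c11 c12 c21 c22 where
    c: "\<And>x y. (c11 *\<^sub>C x + c12 *\<^sub>C y, c21 *\<^sub>C x + c22 *\<^sub>C y) \<in> closure (span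
       {(cop_apply (m * b) h, cop_apply (m * 0) h) | m h. m \<in> M})"
    and b1: "b = c11 *\<^sub>C b + c12 *\<^sub>C 0" and "0 = c21 *\<^sub>C b + c22 *\<^sub>C 0"
    by (rule factor_pair_projection[OF M b z], rule that)
  have b2: "(1 - c11) *\<^sub>C b = 0"
    using b1 scaleC_add_left[of "1 - c11" c11 b] by (simp add: scaleC_one scaleC_zero_right)
  have c1: "c11 = 1"
  proof (rule ccontr)
    assume "c11 \<noteq> 1"
    then have "inverse (1 - c11) *\<^sub>C (1 - c11) *\<^sub>C b = b"
      by (simp add: scaleC_scaleC scaleC_one)
    then show False using b2 \<open>b \<noteq> 0\<close> by (simp add: scaleC_zero_right)
  qed
  have "cop_apply a (fst (c11 *\<^sub>C x + c12 *\<^sub>C y, c21 *\<^sub>C x + c22 *\<^sub>C y)) = 0" for x y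
  proof (rule closure_span_kernel[OF _ _ c])
    show "bounded_linear (\<lambda>p. cop_apply a (fst p))"
      by (intro bounded_linear_compose[OF bounded_linear_cop_apply] bounded_linear_fst)
    show "cop_apply a (fst s) = 0" if s: "s \<in> {(cop_apply (m * b) h, cop_apply (m * 0) h) | m h. m \<in> M}" for s
    proof -
      from s obtain m h where "m \<in> M" "fst s = cop_apply (m * b) h" by auto
      then show ?thesis using ab[of m]
        by (simp add: cop_apply_mult[symmetric] mult.assoc zero_cop.rep_eq)
    qed
  qed
  from this[of _ 0] have "cop_apply a x = 0" for x
    by (simp add: c1 scaleC_one) (metis add.right_neutral add_left_cancel scaleC_add_right)
  then show ?thesis by (intro cop_eqI) (simp add: zero_cop.rep_eq)
qed

text \<open>The hypothesis makes \<open>b * m\<close> on the first coordinate agree with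
  \<open>a * m\<close> on the second throughout the closed span. Either the equation for
  \<open>a\<close> is already a nontrivial linear relation, or this agreement and primeness give
  \<open>c22 = 0\<close> and \<open>b = c21 *\<^sub>C a\<close>.\<close>

lemma factor_extended_centroid:
  assumes M: "factor M" and a: "a \<in> M" and b: "b \<in> M"
    and ab: "\<And>m. m \<in> M \<Longrightarrow> a * m * b = b * m * a" and "b \<noteq> 0"
  shows "\<exists>c. a = c *\<^sub>C b"
proof (cases "a = 0")
  case True
  then show ?thesis by (metis scaleC_zero_left)
next
  case a0: False
  obtain c11 c12 c21 c22 where
    c: "\<And>x y. (c11 *\<^sub>C x + c12 *\<^sub>C y, c21 *\<^sub>C x + c22 *\<^sub>C y) \<in> closure (span
       {(cop_apply (m * a) h, cop_apply (m * b) h) | m h. m \<in> M})"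
    and ca: "a = c11 *\<^sub>C a + c12 *\<^sub>C b" and cb: "b = c21 *\<^sub>C a + c22 *\<^sub>C b"
    by (rule factor_pair_projection[OF M a b], rule that)
  have rel: "cop_apply (b * m) (c11 *\<^sub>C x + c12 *\<^sub>C y) = cop_apply (a * m) (c21 *\<^sub>C x + c22 *\<^sub>C y)"
    if m: "m \<in> M" for m x y
  proof -
    have "cop_apply (b * m) (fst (c11 *\<^sub>C x + c12 *\<^sub>C y, c21 *\<^sub>C x + c22 *\<^sub>C y))
       - cop_apply (a * m) (snd (c11 *\<^sub>C x + c12 *\<^sub>C y, c21 *\<^sub>C x + c22 *\<^sub>C y)) = 0"
    proof (rule closure_span_kernel[OF _ _ c])
      show "bounded_linear (\<lambda>p. cop_apply (b * m) (fst p) - cop_apply (a * m) (snd p))"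
        by (intro bounded_linear_sub bounded_linear_compose[OF bounded_linear_cop_apply]
            bounded_linear_fst bounded_linear_snd)
      show "cop_apply (b * m) (fst s) - cop_apply (a * m) (snd s) = 0"
        if s: "s \<in> {(cop_apply (m * a) h, cop_apply (m * b) h) | m h. m \<in> M}" for s
      proof -
        from s obtain n h where n: "n \<in> M" "s = (cop_apply (n * a) h, cop_apply (n * b) h)" by auto
        then show ?thesis using ab[OF factor_closed(3)[OF M m n(1)]]
          by (simp add: cop_apply_mult[symmetric] mult.assoc)
      qed
    qed
    then show ?thesis by simp
  qed
  show ?thesis
  proof (cases "c12 = 0 \<and> c11 = 1")
    case False
    \<comment> \<open>Some coefficient here is nonzero; for \<open>c11 = 1\<close> the relation
      would force \<open>b = 0\<close>.\<close>
    have e: "(1 - c11) *\<^sub>C a = c12 *\<^sub>C b"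
      using ca scaleC_add_left[of "1 - c11" c11 a] by (simp add: scaleC_one)
        (metis add_right_cancel add.commute)
    show ?thesis
    proof (cases "c11 = 1")
      case True
      then have "inverse c12 *\<^sub>C c12 *\<^sub>C b = 0"
        using e by (metis scaleC_zero_right diff_self scaleC_zero_left)
      then show ?thesis using False True \<open>b \<noteq> 0\<close> by (simp add: scaleC_scaleC scaleC_one)
    next
      case c11: False
      then have "a = inverse (1 - c11) *\<^sub>C (1 - c11) *\<^sub>C a"
        by (simp add: scaleC_scaleC scaleC_one)
      also have "\<dots> = (inverse (1 - c11) * c12) *\<^sub>C b" by (simp add: e scaleC_scaleC)
      finally show ?thesis by blast
    qed
  next
    case True
    have "b = c21 *\<^sub>C a"
    proof -
      have "cop_apply (a * m) (c22 *\<^sub>C y) = 0" if "m \<in> M" for m y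
        using rel[OF that, of 0 y] True by (simp add: scaleC_zero_right cop_apply_zero scaleC_zero_left)
      then have "a * m * (c22 *\<^sub>C 1) = 0" if "m \<in> M" for m
        using that by (intro cop_eqI)
          (simp add: cop_apply_mult scaleC_cop.rep_eq one_cop.rep_eq zero_cop.rep_eq)
      moreover have "c22 *\<^sub>C 1 \<in> M" using factor_closed(1,4)[OF M] by blast
      ultimately have "c22 *\<^sub>C 1 = (0 :: 'a cop)" using factor_prime[OF M a] a0 by blast
      then have "c22 *\<^sub>C b = 0" by (metis cop_mult_scaleC_left mult_1 mult_zero_left)
      then show ?thesis using cb by simp
    qed
    moreover from this have "c21 \<noteq> 0" using \<open>b \<noteq> 0\<close> scaleC_zero_left by metis
    ultimately have "a = inverse c21 *\<^sub>C b" by (simp add: scaleC_scaleC scaleC_one)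
    then show ?thesis by blast
  qed
qed


section \<open>Derivations of centrally closed prime algebras\<close>

text \<open>The ring-theoretic part sees factors only through these properties.
  \<open>extended_centroid\<close> is an elementary form of the statement that the extended centroid
  consists of scalars. Since \<open>0 \<noteq> 1\<close> is not imposed, operators on the zero
  Hilbert space are covered.\<close>

locale centrally_closed_prime_algebra =
  fixes M :: "'a::{ring,monoid_mult,complex_vector} set"
  assumes mult_scaleC_left: "\<And>a b :: 'a. (c *\<^sub>C a) * b = c *\<^sub>C (a * b)"
    and mult_scaleC_right: "\<And>a b :: 'a. a * (c *\<^sub>C b) = c *\<^sub>C (a * b)"
    and one_in [simp]: "1 \<in> M"
    and add_in [simp]: "a \<in> M \<Longrightarrow> b \<in> M \<Longrightarrow> a + b \<in> M"
    and mult_in [simp]: "a \<in> M \<Longrightarrow> b \<in> M \<Longrightarrow> a * b \<in> M"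
    and scaleC_in [simp]: "a \<in> M \<Longrightarrow> c *\<^sub>C a \<in> M"
    and prime: "a \<in> M \<Longrightarrow> b \<in> M \<Longrightarrow> (\<And>m. m \<in> M \<Longrightarrow> a * m * b = 0) \<Longrightarrow> b \<noteq> 0 \<Longrightarrow> a = 0"
    and extended_centroid: "a \<in> M \<Longrightarrow> b \<in> M \<Longrightarrow> (\<And>m. m \<in> M \<Longrightarrow> a * m * b = b * m * a) \<Longrightarrow> b \<noteq> 0
      \<Longrightarrow> \<exists>c. a = c *\<^sub>C b"
    and central_scalar: "a \<in> M \<Longrightarrow> (\<And>b. b \<in> M \<Longrightarrow> a * b = b * a) \<Longrightarrow> \<exists>c. a = c *\<^sub>C 1"
begin

lemmas scale_simps = scaleC_add_right scaleC_add_left scaleC_diff_right scaleC_diff_left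
  scaleC_minus_right scaleC_minus_left scaleC_scaleC scaleC_one scaleC_zero_left scaleC_zero_right
  mult_scaleC_left mult_scaleC_right

lemma zero_in [simp]: "0 \<in> M"
  using scaleC_in[OF one_in, of 0] by (simp add: scaleC_zero_left)

lemma uminus_in [simp]: "a \<in> M \<Longrightarrow> - a \<in> M"
  using scaleC_in[of a "- 1"] by (simp add: scale_simps)

lemma diff_in [simp]: "a \<in> M \<Longrightarrow> b \<in> M \<Longrightarrow> a - b \<in> M"
  using add_in[of a "- b"] by simp

text \<open>Write \<open>[a, b]\<close> for \<open>a * b - b * a\<close>. As
  \<open>[a, a * b] = a * [a, b]\<close> is central too, commuting it with \<open>x\<close> gives
  \<open>[x, a] * [a, b] = 0\<close>. With \<open>b * m\<close> for \<open>x\<close> this becomes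
  \<open>[b, a] * m * [a, b] = 0\<close>, and primeness applies.\<close>

lemma commutative_if_commutators_central:
  assumes central: "\<And>a b c. a \<in> M \<Longrightarrow> b \<in> M \<Longrightarrow> c \<in> M \<Longrightarrow> (a * b - b * a) * c = c * (a * b - b * a)"
    and a: "a \<in> M" and b: "b \<in> M"
  shows "a * b = b * a"
proof -
  have sq: "(x * a - a * x) * (a * b - b * a) = 0" if "x \<in> M" for x
  proof -
    have "(x * a - a * x) * (a * b - b * a)
      = (x * (a * (a * b) - (a * b) * a) - (a * (a * b) - (a * b) * a) * x)
        - a * (x * (a * b - b * a) - (a * b - b * a) * x)"
      by (simp add: algebra_simps)
    then show ?thesis using central[of a "a * b" x] central[of a b x] a b that by simp
  qed
  have "(b * a - a * b) * m * (a * b - b * a) = 0" if m: "m \<in> M" for m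
  proof -
    have "(b * m * a - a * (b * m)) * (a * b - b * a)
      = b * ((m * a - a * m) * (a * b - b * a)) + (b * a - a * b) * m * (a * b - b * a)"
      by (simp add: algebra_simps)
    then show ?thesis using sq[of "b * m"] sq[of m] m b by simp
  qed
  then have "b * a - a * b = 0 \<or> a * b - b * a = 0"
    using prime[of "b * a - a * b" "a * b - b * a"] a b by auto
  then show ?thesis by auto
qed

section \<open>Jordan derivations\<close>

text \<open>The instances at \<open>x\<close>, \<open>y\<close> and \<open>x * p * y\<close> combine
  to twice \<open>p * x * (p * y * q)\<close>; primeness is then used twice.\<close>

lemma anticommuting_products_zero:
  assumes p: "p \<in> M" and q: "q \<in> M"
    and pq: "\<And>x. x \<in> M \<Longrightarrow> p * x * q + q * x * p = 0"
  shows "p = 0 \<or> q = 0"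
proof (rule ccontr)
  assume "\<not> (p = 0 \<or> q = 0)"
  then have p0: "p \<noteq> 0" and q0: "q \<noteq> 0" by auto
  have "p * x * (p * y * q) = 0" if x: "x \<in> M" and y: "y \<in> M" for x y
  proof (rule add_self_eq_0)
    have "p * x * (p * y * q) + p * x * (p * y * q)
      = p * x * (p * y * q + q * y * p) - (p * x * q + q * x * p) * y * p
        + (p * (x * p * y) * q + q * (x * p * y) * p)"
      by (simp add: algebra_simps)
    then show "p * x * (p * y * q) + p * x * (p * y * q) = 0"
      using pq[of x] pq[of y] pq[of "x * p * y"] x y p by simp
  qed
  then have "p * y * q = 0" if "y \<in> M" for y
    using prime[of p "p * y * q"] p q p0 that by auto
  then show False using prime[of p q] p q p0 q0 by blast
qed

text \<open>Herstein's theorem on Jordan derivations of prime rings. In the noncommutative case,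
  evaluating \<open>L\<close> on one element in two ways shows that the defect \<open>G x y\<close>
  and the commutator of \<open>x\<close> and \<open>y\<close> satisfy the hypothesis of
  \<open>anticommuting_products_zero\<close>.\<close>

lemma jordan_derivation:
  assumes L_in: "\<And>a. a \<in> M \<Longrightarrow> L a \<in> M"
    and L_add: "\<And>a b. a \<in> M \<Longrightarrow> b \<in> M \<Longrightarrow> L (a + b) = L a + L b"
    and L_jordan: "\<And>a b. a \<in> M \<Longrightarrow> b \<in> M \<Longrightarrow>
      L (a * b + b * a) = L a * b + b * L a + a * L b + L b * a"
    and a: "a \<in> M" and b: "b \<in> M"
  shows "L (a * b) = L a * b + a * L b"
proof (cases "\<forall>a\<in>M. \<forall>b\<in>M. a * b = b * a")
  case True
  have "L (a * b) + L (a * b) = (L a * b + a * L b) + (L a * b + a * L b)"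
    using L_jordan[OF a b] True a b L_in by (simp add: L_add)
  then have "(L (a * b) - (L a * b + a * L b)) + (L (a * b) - (L a * b + a * L b)) = 0"
    by (simp add: algebra_simps)
  then show ?thesis using add_self_eq_0 by fastforce
next
  case False
  then obtain a0 b0 where a0: "a0 \<in> M" and b0: "b0 \<in> M" and ab0: "a0 * b0 \<noteq> b0 * a0" by blast
  have triple: "L (x * y * x) = L x * y * x + x * L y * x + x * y * L x"
    if x: "x \<in> M" and y: "y \<in> M" for x y
  proof -
    have sq: "L (x * x) = L x * x + x * L x"
    proof -
      have "(L (x * x) - (L x * x + x * L x)) + (L (x * x) - (L x * x + x * L x)) = 0"
        using L_jordan[OF x x] x by (simp add: L_add algebra_simps)
      then show ?thesis using add_self_eq_0 by fastforce
    qed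
    \<comment> \<open>The iterated Jordan product of \<open>x\<close>, \<open>x\<close> and
      \<open>y\<close> is the Jordan product of \<open>x * x\<close> and \<open>y\<close> plus twice
      \<open>x * y * x\<close>, so the Jordan identity determines
      \<open>L (x * y * x)\<close>.\<close>
    have "L (x * (x * y + y * x) + (x * y + y * x) * x)
        = L (x * x * y + y * (x * x)) + (L (x * y * x) + L (x * y * x))"
      using x y by (simp add: L_add[symmetric] algebra_simps)
    then have "(L (x * y * x) - (L x * y * x + x * L y * x + x * y * L x))
       + (L (x * y * x) - (L x * y * x + x * L y * x + x * y * L x)) = 0"
      using x y L_jordan[of x "x * y + y * x"] L_jordan[of "x * x" y] L_jordan[of x y] sq
      by (simp add: algebra_simps)
    then show ?thesis using add_self_eq_0 by fastforce
  qed
  have triple_linear: "L (x * y * z + z * y * x) = L x * y * z + x * L y * z + x * y * L z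
       + L z * y * x + z * L y * x + z * y * L x"
    if x: "x \<in> M" and y: "y \<in> M" and z: "z \<in> M" for x y z
  proof -
    have "L ((x + z) * y * (x + z)) = L (x * y * x) + L (z * y * z) + L (x * y * z + z * y * x)"
      using x y z by (simp add: L_add[symmetric] algebra_simps)
    then show ?thesis
      using triple[of "x + z" y] triple[of x y] triple[of z y] x y z
      by (simp add: L_add algebra_simps)
  qed
  define G where "G x y = L (x * y) - (L x * y + x * L y)" for x y
  have G_in: "G x y \<in> M" if "x \<in> M" "y \<in> M" for x y using that by (simp add: G_def L_in)
  have G_add: "G (x + x') y = G x y + G x' y" "G y (x + x') = G y x + G y x'"
    if "x \<in> M" "x' \<in> M" "y \<in> M" for x x' y
    using that by (simp_all add: G_def L_add algebra_simps)
  have G_swap: "L (x * y) = G x y + (L x * y + x * L y)" "L (y * x) = L y * x + y * L x - G x y"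
    if "x \<in> M" "y \<in> M" for x y
    using L_jordan[OF that] that by (simp_all add: G_def L_add algebra_simps)
  have dichotomy: "G x y = 0 \<or> x * y = y * x" if x: "x \<in> M" and y: "y \<in> M" for x y
  proof -
    have "G x y * z * (x * y - y * x) + (x * y - y * x) * z * G x y = 0" if z: "z \<in> M" for z
    proof -
      \<comment> \<open>\<open>triple\<close> evaluates the left side and
        \<open>triple_linear\<close> the right side; their difference is the sum claimed to
        vanish.\<close>
      have "L (x * (y * z * y) * x) + L (y * (x * z * x) * y)
          = L ((x * y) * z * (y * x) + (y * x) * z * (x * y))"
        using x y z by (simp add: L_add algebra_simps)
      then show ?thesis
        using triple[of x "y * z * y"] triple[of y "x * z * x"] triple[OF x z] triple[OF y z]
          triple_linear[of "x * y" z "y * x"] G_swap[OF x y] x y z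
        by (simp add: algebra_simps)
    qed
    then have "G x y = 0 \<or> x * y - y * x = 0"
      using x y by (intro anticommuting_products_zero G_in) auto
    then show ?thesis by simp
  qed
  have "G a b = 0"
  proof (rule ccontr)
    assume nz: "G a b \<noteq> 0"
    have ab: "a * b = b * a" using dichotomy[OF a b] nz by blast
    \<comment> \<open>Otherwise \<open>a\<close> commutes with neither \<open>c\<close> nor
      \<open>b + c\<close>, so \<open>G a c\<close> and \<open>G a (b + c)\<close> vanish, and with
      them \<open>G a b\<close>. The same argument makes \<open>b\<close> central.\<close>
    have ac: "a * c = c * a" if c: "c \<in> M" for c
      using dichotomy[OF a c] dichotomy[of a "b + c"] a b c nz ab G_add(2)[of b c a]
      by (auto simp: algebra_simps)
    have bc: "c * b = b * c" if c: "c \<in> M" for c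
      using dichotomy[OF c b] dichotomy[of "a + c" b] a b c nz ab G_add(1)[of a c b]
      by (auto simp: algebra_simps)
    \<comment> \<open>Adding the central \<open>a\<close> and \<open>b\<close> does not change the
      commutator of \<open>a0\<close> and \<open>b0\<close>, so all four defects vanish.
      Biadditivity then gives \<open>G a b = 0\<close>.\<close>
    have "G (a + a0) (b + b0) = 0 \<and> G a0 b0 = 0 \<and> G (a + a0) b0 = 0 \<and> G a0 (b + b0) = 0"
      using dichotomy[of "a + a0" "b + b0"] dichotomy[of a0 b0] dichotomy[of "a + a0" b0]
        dichotomy[of a0 "b + b0"] a b a0 b0 ac[of b0] ac[of b] bc[of a0] ab0
      by (auto simp: algebra_simps)
    then have "G a b + G a b0 + G a0 b = 0" and "G a0 b0 = 0"
      and "G a b0 + G a0 b0 = 0" and "G a0 b + G a0 b0 = 0"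
      using a b a0 b0 by (auto simp: G_add algebra_simps)
    then show False using nz by simp
  qed
  then show ?thesis by (simp add: G_def)
qed

section \<open>Linear dependence from functional identities\<close>

text \<open>Substituting \<open>y * a2 * z\<close> for \<open>z\<close> and subtracting
  \<open>a2 * y\<close> times the relation removes \<open>b2\<close>. If
  \<open>b1 \<noteq> 0\<close>, primeness and the extended centroid make \<open>a1\<close> a
  multiple of \<open>a2\<close>, and the two terms merge.\<close>

lemma right_dependent2:
  assumes in_M: "a1 \<in> M" "a2 \<in> M" "b1 \<in> M" "b2 \<in> M"
    and rel: "\<And>z. z \<in> M \<Longrightarrow> a1 * z * b1 + a2 * z * b2 = 0" and a2: "a2 \<noteq> 0"
  shows "\<exists>c. b2 = c *\<^sub>C b1"
proof (cases "b1 = 0")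
  case True
  then have "b2 = 0" using prime[OF in_M(2,4)] rel a2 by auto
  then show ?thesis using scaleC_zero_left by metis
next
  case False
  have "a1 * y * a2 - a2 * y * a1 = 0" if y: "y \<in> M" for y
  proof (rule prime[OF _ in_M(3) _ False])
    fix z assume z: "z \<in> M"
    have "(a1 * y * a2 - a2 * y * a1) * z * b1
      = (a1 * (y * a2 * z) * b1 + a2 * (y * a2 * z) * b2) - a2 * y * (a1 * z * b1 + a2 * z * b2)"
      by (simp add: algebra_simps)
    then show "(a1 * y * a2 - a2 * y * a1) * z * b1 = 0"
      using rel[of "y * a2 * z"] rel[of z] in_M y z by simp
  qed (use in_M y in auto)
  then obtain c where c: "a1 = c *\<^sub>C a2" using extended_centroid[OF in_M(1,2)] a2 by auto
  have "c *\<^sub>C b1 + b2 = 0"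
  proof (rule ccontr)
    assume nz: "c *\<^sub>C b1 + b2 \<noteq> 0"
    have "a2 = 0"
    proof (rule prime[OF in_M(2) _ _ nz])
      show "a2 * z * (c *\<^sub>C b1 + b2) = 0" if "z \<in> M" for z
        using rel[OF that] by (simp add: c scale_simps algebra_simps)
    qed (use in_M in auto)
    then show False using a2 by simp
  qed
  then have "b2 = (- c) *\<^sub>C b1" by (simp add: scaleC_minus_left eq_neg_iff_add_eq_0 add.commute)
  then show ?thesis by blast
qed

text \<open>If \<open>a2\<close> is a multiple of \<open>a3\<close>, the last two terms merge.
  Otherwise a substitution with \<open>a3\<close> removes \<open>b3\<close>, so \<open>b2\<close> is
  a multiple of \<open>b1\<close> and the first two terms merge.\<close>

lemma right_dependent3:
  assumes in_M: "a1 \<in> M" "a2 \<in> M" "a3 \<in> M" "b1 \<in> M" "b2 \<in> M" "b3 \<in> M"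
    and rel: "\<And>z. z \<in> M \<Longrightarrow> a1 * z * b1 + a2 * z * b2 + a3 * z * b3 = 0" and a3: "a3 \<noteq> 0"
  shows "\<exists>c d. b3 = c *\<^sub>C b1 + d *\<^sub>C b2"
proof (cases "\<forall>y\<in>M. a2 * y * a3 = a3 * y * a2")
  case True
  then obtain c where c: "a2 = c *\<^sub>C a3" using extended_centroid[OF in_M(2,3)] a3 by auto
  have "\<exists>d. c *\<^sub>C b2 + b3 = d *\<^sub>C b1"
  proof (rule right_dependent2[OF in_M(1,3,4) _ _ a3])
    show "a1 * z * b1 + a3 * z * (c *\<^sub>C b2 + b3) = 0" if "z \<in> M" for z
      using rel[OF that] by (simp add: c scale_simps algebra_simps)
  qed (use in_M in auto)
  then obtain d where "c *\<^sub>C b2 + b3 = d *\<^sub>C b1" by blast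
  then have "b3 = d *\<^sub>C b1 + (- c) *\<^sub>C b2"
    by (metis add.commute add_diff_cancel_left' diff_conv_add_uminus scaleC_minus_left)
  then show ?thesis by blast
next
  case False
  then obtain y where y: "y \<in> M" "a2 * y * a3 - a3 * y * a2 \<noteq> 0" by auto
  have "\<exists>c. b2 = c *\<^sub>C b1"
  proof (rule right_dependent2[OF _ _ in_M(4,5) _ y(2)])
    fix z assume z: "z \<in> M"
    have "(a1 * y * a3 - a3 * y * a1) * z * b1 + (a2 * y * a3 - a3 * y * a2) * z * b2
      = (a1 * (y * a3 * z) * b1 + a2 * (y * a3 * z) * b2 + a3 * (y * a3 * z) * b3)
        - a3 * y * (a1 * z * b1 + a2 * z * b2 + a3 * z * b3)"
      by (simp add: algebra_simps)
    then show "(a1 * y * a3 - a3 * y * a1) * z * b1 + (a2 * y * a3 - a3 * y * a2) * z * b2 = 0"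
      using rel[of "y * a3 * z"] rel[of z] in_M y z by simp
  qed (use in_M y in auto)
  then obtain c where c: "b2 = c *\<^sub>C b1" by blast
  have "\<exists>d. b3 = d *\<^sub>C b1"
  proof (rule right_dependent2[OF _ in_M(3,4,6) _ a3])
    show "(a1 + c *\<^sub>C a2) * z * b1 + a3 * z * b3 = 0" if "z \<in> M" for z
      using rel[OF that] by (simp add: c scale_simps algebra_simps)
  qed (use in_M in auto)
  then obtain d where "b3 = d *\<^sub>C b1" by blast
  then have "b3 = d *\<^sub>C b1 + 0 *\<^sub>C b2" by (simp add: scaleC_zero_left)
  then show ?thesis by blast
qed

text \<open>Substituting \<open>s * z\<close> for \<open>z\<close> and subtracting \<open>s\<close>
  times the relation removes \<open>w\<close>. The coefficient left in front of \<open>z * u\<close>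
  is the nonzero commutator of \<open>t\<close> and \<open>s\<close>.\<close>

lemma dependent_if_commutator_identity:
  assumes in_M: "t \<in> M" "u \<in> M" "p \<in> M" "w \<in> M"
    and rel: "\<And>z. z \<in> M \<Longrightarrow> p * z - u * z * t + t * z * u + z * w = 0"
    and s: "s \<in> M" "t * s \<noteq> s * t"
  shows "\<exists>a b. u = a *\<^sub>C 1 + b *\<^sub>C t"
proof (rule right_dependent3)
  show "(p * s - s * p) * z * 1 + (- (u * s - s * u)) * z * t + (t * s - s * t) * z * u = 0"
    if z: "z \<in> M" for z
  proof -
    have "(p * s - s * p) * z * 1 + (- (u * s - s * u)) * z * t + (t * s - s * t) * z * u
      = (p * (s * z) - u * (s * z) * t + t * (s * z) * u + (s * z) * w)
        - s * (p * z - u * z * t + t * z * u + z * w)"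
      by (simp add: algebra_simps)
    then show ?thesis using rel[of "s * z"] rel[of z] z s by simp
  qed
qed (use in_M s in auto)

section \<open>\<xi>-Lie derivations for \<xi> different from 1 and -1\<close>

text \<open>Here \<open>L\<close> minus multiplication by \<open>l\<close> is a derivation. In a
  commutative algebra \<open>l\<close> may be nonzero, so its vanishing is tied to a noncommuting
  pair.\<close>

lemma xi_Lie_derivation:
  assumes L_in: "\<And>a. a \<in> M \<Longrightarrow> L a \<in> M"
    and L_add: "\<And>a b. a \<in> M \<Longrightarrow> b \<in> M \<Longrightarrow> L (a + b) = L a + L b"
    and L_xi: "\<And>a b. a \<in> M \<Longrightarrow> b \<in> M \<Longrightarrow> L (a * b - \<xi> *\<^sub>C (b * a))
      = (L a * b - \<xi> *\<^sub>C (b * L a)) + (a * L b - \<xi> *\<^sub>C (L b * a))"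
    and xi: "\<xi> \<noteq> 1" "\<xi> \<noteq> - 1"
  obtains l where "\<And>a b. a \<in> M \<Longrightarrow> b \<in> M \<Longrightarrow> L (a * b) = L a * b + a * L b - l *\<^sub>C (a * b)"
    and "\<And>a. a \<in> M \<Longrightarrow> L (\<xi> *\<^sub>C a) = \<xi> *\<^sub>C L a - ((1 - \<xi>) * l) *\<^sub>C a"
    and "\<And>a b. a \<in> M \<Longrightarrow> b \<in> M \<Longrightarrow> a * b \<noteq> b * a \<Longrightarrow> l = 0"
proof -
  have L_diff: "L (a - b) = L a - L b" if "a \<in> M" "b \<in> M" for a b
    using L_add[of "a - b" b] that by (simp add: algebra_simps)
  have "L 1 * a = a * L 1" if a: "a \<in> M" for a
  proof -
    have "(1 + \<xi>) *\<^sub>C (L 1 * a - a * L 1) = 0"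
    proof -
      \<comment> \<open>The brackets of \<open>a\<close> with \<open>1\<close> in both orders equal
        \<open>(1 - \<xi>) *\<^sub>C a\<close>, so the two expansions of \<open>L\<close>
        agree.\<close>
      have "(1 + \<xi>) *\<^sub>C (L 1 * a - a * L 1)
        = ((L 1 * a - \<xi> *\<^sub>C (a * L 1)) + (1 * L a - \<xi> *\<^sub>C (L a * 1)))
          - ((L a * 1 - \<xi> *\<^sub>C (1 * L a)) + (a * L 1 - \<xi> *\<^sub>C (L 1 * a)))"
        by (simp add: scale_simps algebra_simps)
      then show ?thesis unfolding L_xi[OF a one_in, symmetric] L_xi[OF one_in a, symmetric] by simp
    qed
    then show ?thesis using xi(2) scaleC_eq_0[of "1 + \<xi>"]
      by (metis add.commute eq_iff_diff_eq_0 eq_neg_iff_add_eq_0)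
  qed
  then obtain l where l: "L 1 = l *\<^sub>C 1" using central_scalar[OF L_in[OF one_in]] by blast
  have L_scale: "L (\<xi> *\<^sub>C a) = \<xi> *\<^sub>C L a - ((1 - \<xi>) * l) *\<^sub>C a" if a: "a \<in> M" for a
    using L_xi[OF a one_in] a by (simp add: l L_diff scale_simps algebra_simps)
  \<comment> \<open>The last term makes \<open>F\<close> the derivation defect of \<open>L\<close>
    minus multiplication by \<open>l\<close>.\<close>
  define F where "F a b = L (a * b) - L a * b - a * L b + l *\<^sub>C (a * b)" for a b
  have F_xi: "F a b - \<xi> *\<^sub>C F b a = l *\<^sub>C (a * b - b * a)" if a: "a \<in> M" and b: "b \<in> M" for a b
    using L_xi[OF a b] a b by (simp add: L_diff L_scale F_def scale_simps algebra_simps)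
  have F_comm: "((1 - \<xi>) * (1 + \<xi>)) *\<^sub>C F a b = ((1 - \<xi>) * l) *\<^sub>C (a * b - b * a)"
    if a: "a \<in> M" and b: "b \<in> M" for a b
  proof -
    have "((1 - \<xi>) * (1 + \<xi>)) *\<^sub>C F a b = (F a b - \<xi> *\<^sub>C F b a) + \<xi> *\<^sub>C (F b a - \<xi> *\<^sub>C F a b)"
      by (simp add: scale_simps algebra_simps)
    also have "\<dots> = ((1 - \<xi>) * l) *\<^sub>C (a * b - b * a)"
      unfolding F_xi[OF a b] F_xi[OF b a] by (simp add: scale_simps algebra_simps)
    finally show ?thesis .
  qed
  have nz: "(1 - \<xi>) * (1 + \<xi>) \<noteq> 0" using xi by (auto simp: add_eq_0_iff)
  have l0: "l = 0" if ab: "a \<in> M" "b \<in> M" "a * b \<noteq> b * a" for a b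
  proof (rule ccontr)
    assume "l \<noteq> 0"
    then have lx: "(1 - \<xi>) * l \<noteq> 0" using xi by simp
    have "(c * x - x * c) * y = y * (c * x - x * c)" if "c \<in> M" "x \<in> M" "y \<in> M" for c x y
    proof -
      \<comment> \<open>The cocycle identity. Once \<open>F_comm\<close> replaces \<open>F\<close>
        by commutators, it says that \<open>c * x - x * c\<close> commutes with
        \<open>y\<close>.\<close>
      have "x * F y c - F (x * y) c + F x (y * c) - F x y * c = 0"
        by (simp add: F_def scale_simps algebra_simps)
      then have "((1 - \<xi>) * (1 + \<xi>)) *\<^sub>C (x * F y c - F (x * y) c + F x (y * c) - F x y * c) = 0"
        by (simp add: scale_simps)
      moreover have "((1 - \<xi>) * (1 + \<xi>)) *\<^sub>C (x * F y c - F (x * y) c + F x (y * c) - F x y * c)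
        = x * ((1 - \<xi>) * (1 + \<xi>)) *\<^sub>C F y c - ((1 - \<xi>) * (1 + \<xi>)) *\<^sub>C F (x * y) c
          + ((1 - \<xi>) * (1 + \<xi>)) *\<^sub>C F x (y * c) - (((1 - \<xi>) * (1 + \<xi>)) *\<^sub>C F x y) * c"
        by (simp only: scaleC_add_right scaleC_diff_right mult_scaleC_left mult_scaleC_right)
      ultimately have "((1 - \<xi>) * l) *\<^sub>C ((c * x - x * c) * y - y * (c * x - x * c)) = 0"
        using that by (simp only: F_comm mult_in) (simp add: mult_scaleC_left mult_scaleC_right
          scaleC_add_right[symmetric] scaleC_diff_right[symmetric] algebra_simps)
      then have "(c * x - x * c) * y - y * (c * x - x * c) = 0" using lx scaleC_eq_0 by blast
      then show ?thesis by simp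
    qed
    then show False using commutative_if_commutators_central ab by blast
  qed
  have F0: "F a b = 0" if "a \<in> M" "b \<in> M" for a b
  proof -
    have "((1 - \<xi>) * l) *\<^sub>C (a * b - b * a) = 0"
      using l0[OF that] by (cases "a * b = b * a") (auto simp: scale_simps)
    then show ?thesis using F_comm[OF that] nz scaleC_eq_0 by metis
  qed
  show ?thesis
  proof (rule that)
    show "L (a * b) = L a * b + a * L b - l *\<^sub>C (a * b)" if "a \<in> M" "b \<in> M" for a b
      using F0[OF that] by (simp add: F_def algebra_simps)
  qed (use L_scale l0 in auto)
qed

section \<open>Lie derivations\<close>

text \<open>The defect \<open>F\<close> is first determined against the fixed element
  \<open>t\<close>, where independence of \<open>1\<close> and \<open>t\<close> allows coefficients
  to be compared. Independence of \<open>t * t\<close> then extends the formula to all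
  pairs.\<close>

lemma Lie_derivation:
  assumes L_in: "\<And>a. a \<in> M \<Longrightarrow> L a \<in> M"
    and L_add: "\<And>a b. a \<in> M \<Longrightarrow> b \<in> M \<Longrightarrow> L (a + b) = L a + L b"
    and L_Lie: "\<And>a b. a \<in> M \<Longrightarrow> b \<in> M \<Longrightarrow>
      L (a * b - b * a) = (L a * b - b * L a) + (a * L b - L b * a)"
    and t: "t \<in> M"
    and indep: "\<And>a b c. a *\<^sub>C 1 + b *\<^sub>C t + c *\<^sub>C (t * t) = 0 \<Longrightarrow> a = 0 \<and> b = 0 \<and> c = 0"
  obtains h :: "'a \<Rightarrow> complex"
  where "\<And>a b. a \<in> M \<Longrightarrow> b \<in> M \<Longrightarrow> h (a + b) = h a + h b"
    and "\<And>a b. a \<in> M \<Longrightarrow> b \<in> M \<Longrightarrow> h (a * b - b * a) = 0"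
    and "\<And>a b. a \<in> M \<Longrightarrow> b \<in> M \<Longrightarrow>
      L (a * b) - h (a * b) *\<^sub>C 1 = (L a - h a *\<^sub>C 1) * b + a * (L b - h b *\<^sub>C 1)"
proof -
  have indep2: "a = a' \<and> b = b'" if "a *\<^sub>C 1 + b *\<^sub>C t = a' *\<^sub>C 1 + b' *\<^sub>C t" for a b a' b'
    using indep[of "a - a'" "b - b'" 0] that by (simp add: scale_simps algebra_simps)
  obtain s where s: "s \<in> M" "t * s \<noteq> s * t"
  proof (rule ccontr)
    assume "\<not> thesis"
    then have "\<forall>b\<in>M. t * b = b * t" using that by blast
    then obtain c where "t = c *\<^sub>C 1" using central_scalar t by blast
    then show False using indep2[of c 0 0 1] by (simp add: scale_simps)
  qed
  have L_diff: "L (a - b) = L a - L b" if "a \<in> M" "b \<in> M" for a b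
    using L_add[of "a - b" b] that by (simp add: algebra_simps)
  define F where "F x y = L (x * y) - L x * y - x * L y" for x y
  have F_in: "F x y \<in> M" if "x \<in> M" "y \<in> M" for x y using that by (simp add: F_def L_in)
  have F_add: "F (x + x') y = F x y + F x' y"
    if "x \<in> M" "x' \<in> M" "y \<in> M" for x x' y
    using that by (simp_all add: F_def L_add algebra_simps)
  have F_sym: "F x y = F y x" if "x \<in> M" "y \<in> M" for x y
    using L_Lie[OF that] that by (simp add: F_def L_diff algebra_simps)
  have F_coc: "x * F y z + F x (y * z) = F (x * y) z + F x y * z" for x y z
    by (simp add: F_def algebra_simps)
  \<comment> \<open>Sum of three cyclic copies of the cocycle identity; by symmetry the values of
    \<open>F\<close> at products cancel.\<close>
  have cyc: "(x * F y z - F y z * x) + (y * F z x - F z x * y) + (z * F x y - F x y * z) = 0"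
    if x: "x \<in> M" and y: "y \<in> M" and z: "z \<in> M" for x y z
  proof -
    have "(x * F y z - F y z * x) + (y * F z x - F z x * y) + (z * F x y - F x y * z)
      = (x * F y z + F x (y * z) - F (x * y) z - F x y * z)
        + (y * F z x + F y (z * x) - F (y * z) x - F y z * x)
        + (z * F x y + F z (x * y) - F (z * x) y - F z x * y)"
      using F_sym[of x "y * z"] F_sym[of y "z * x"] F_sym[of z "x * y"] x y z
      by (simp add: algebra_simps)
    then show ?thesis by (simp add: F_coc)
  qed
  define f where "f x = F x t" for x
  have f_in: "f x \<in> M" if "x \<in> M" for x using that t by (simp add: f_def F_in)
  have F_yt: "F x (y * t) = F x y * t + f (x * y) - x * f y" for x y
    using F_coc[of x y t] by (simp add: f_def algebra_simps)
  \<comment> \<open>With this half, \<open>cyc\<close> at \<open>x\<close>, \<open>t\<close>,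
    \<open>t\<close> becomes \<open>tf\<close>. At \<open>x = t\<close> that forces three times the
    commutator of \<open>t\<close> and \<open>q\<close> to vanish.\<close>
  define q where "q = (1/2) *\<^sub>C f t"
  have q_in: "q \<in> M" using f_in t by (simp add: q_def)
  have ft: "f t = q + q" by (simp add: q_def scaleC_add_left[symmetric] scaleC_one)
  have tf: "t * f x - f x * t = q * x - x * q" if x: "x \<in> M" for x
  proof -
    have "((t * f x - f x * t) - (q * x - x * q)) + ((t * f x - f x * t) - (q * x - x * q)) = 0"
      using cyc[OF x t t] F_sym[OF t x] ft by (simp add: f_def algebra_simps)
    then show ?thesis using add_self_eq_0 by fastforce
  qed
  have tq: "t * q = q * t"
  proof -
    have "3 *\<^sub>C (t * q - q * t) = (t * f t - f t * t) - (q * t - t * q)"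
      using scaleC_add_left[of 2 1 "t * q - q * t"] scaleC_add_left[of 1 1 "t * q - q * t"]
      by (simp add: ft scaleC_one algebra_simps)
    then have "3 *\<^sub>C (t * q - q * t) = 0" using tf[OF t] by simp
    then have "t * q - q * t = 0" by (rule scaleC_eq_0) simp
    then show ?thesis by simp
  qed
  have cyc_t: "x * (t * F y z - F y z * t) + F z x * (y * t - t * y)
      + (y * (f (z * x) - z * f x) - (f (z * x) - z * f x) * y)
      + F y x * (z * t - t * z)
      + (z * (f (y * x) - y * f x) - (f (y * x) - y * f x) * z) = 0"
    if x: "x \<in> M" and y: "y \<in> M" and z: "z \<in> M" for x y z
  proof -
    have e1: "((x * t) * F y z - F y z * (x * t)) + (y * F z (x * t) - F z (x * t) * y)
        + (z * F y (x * t) - F y (x * t) * z) = 0"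
      using cyc[of "x * t" y z] F_sym[of "x * t" y] x y z t by simp
    have e2: "((x * F y z - F y z * x) + (y * F z x - F z x * y) + (z * F y x - F y x * z)) * t = 0"
      using cyc[of x y z] F_sym[of x y] x y z by simp
    have "x * (t * F y z - F y z * t) + F z x * (y * t - t * y)
      + (y * (f (z * x) - z * f x) - (f (z * x) - z * f x) * y)
      + F y x * (z * t - t * z)
      + (z * (f (y * x) - y * f x) - (f (y * x) - y * f x) * z)
      = (((x * t) * F y z - F y z * (x * t)) + (y * F z (x * t) - F z (x * t) * y)
        + (z * F y (x * t) - F y (x * t) * z))
       - ((x * F y z - F y z * x) + (y * F z x - F z x * y) + (z * F y x - F y x * z)) * t"
      by (simp add: F_yt algebra_simps)
    then show ?thesis by (simp only: e1 e2) simp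
  qed
  \<comment> \<open>The same difference at \<open>x\<close>, \<open>z\<close>, \<open>t\<close>,
    with \<open>tf\<close> trading commutators of \<open>t\<close> with values of \<open>f\<close>
    for commutators with \<open>q\<close>.\<close>
  have J: "(q * (z * x) - z * x * q) - (t * z - z * t) * f x - z * (q * x - x * q)
      + x * (q * z - z * q) + (z * f (x * t) - f (x * t) * z) - (z * f x - f x * z) * t = 0"
    if x: "x \<in> M" and z: "z \<in> M" for x z
  proof -
    have e1: "((x * t) * f z - f z * (x * t)) + (z * f (x * t) - f (x * t) * z)
        + (t * F z (x * t) - F z (x * t) * t) = 0"
      using cyc[of "x * t" z t] F_sym[of "x * t" z] F_sym[of t "x * t"] x z t
      by (simp add: f_def)
    have e2: "((x * f z - f z * x) + (z * f x - f x * z) + (t * F z x - F z x * t)) * t = 0"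
      using cyc[of x z t] F_sym[of x z] F_sym[of t x] x z t by (simp add: f_def)
    have "(q * (z * x) - z * x * q) - (t * z - z * t) * f x - z * (q * x - x * q)
      + x * (q * z - z * q) + (z * f (x * t) - f (x * t) * z) - (z * f x - f x * z) * t
      = (t * f (z * x) - f (z * x) * t) - (t * z - z * t) * f x - z * (t * f x - f x * t)
      + x * (t * f z - f z * t) + (z * f (x * t) - f (x * t) * z) - (z * f x - f x * z) * t"
      using tf[of "z * x"] tf[OF x] tf[OF z] x z by simp
    also have "\<dots> = (((x * t) * f z - f z * (x * t)) + (z * f (x * t) - f (x * t) * z)
        + (t * F z (x * t) - F z (x * t) * t))
      - ((x * f z - f z * x) + (z * f x - f x * z) + (t * F z x - F z x * t)) * t"
      by (simp add: F_yt algebra_simps)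
    finally show ?thesis by (simp only: e1 e2) simp
  qed
  \<comment> \<open>At \<open>x = t\<close>, \<open>J\<close> takes the shape required by
    \<open>dependent_if_commutator_identity\<close>, with three times \<open>q\<close> in the role
    of \<open>u\<close>.\<close>
  have "\<exists>a b. q + q + q = a *\<^sub>C 1 + b *\<^sub>C t"
  proof (rule dependent_if_commutator_identity[OF t _ _ _ _ s])
    show "(f (t * t) - t * q) * z - (q + q + q) * z * t + t * z * (q + q + q) + z * (t * q - f (t * t)) = 0"
      if z: "z \<in> M" for z
    proof -
      have "(f (t * t) - t * q) * z - (q + q + q) * z * t + t * z * (q + q + q) + z * (t * q - f (t * t))
        = - ((q * (z * t) - z * t * q) - (t * z - z * t) * f t - z * (q * t - t * q)
      + t * (q * z - z * q) + (z * f (t * t) - f (t * t) * z) - (z * f t - f t * z) * t)"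
        using tq mult.assoc[of t q z] mult.assoc[of q t z] by (simp add: ft algebra_simps)
      then show ?thesis using J[OF t z] by simp
    qed
  qed (use t q_in f_in in auto)
  then obtain al3 be3 where q3: "q + q + q = al3 *\<^sub>C 1 + be3 *\<^sub>C t" by blast
  define al where "al = al3 / 3"
  define be where "be = be3 / 3"
  have q: "q = al *\<^sub>C 1 + be *\<^sub>C t"
  proof -
    have "q = (1/3) *\<^sub>C (q + q + q)"
      by (simp add: scaleC_add_right scaleC_add_left[symmetric] scaleC_one)
    then show ?thesis unfolding q3 by (simp add: scale_simps al_def be_def)
  qed
  \<comment> \<open>Since the commutators with \<open>q\<close> are \<open>be\<close> times those
    with \<open>t\<close>, this correction makes \<open>u x\<close> commute with
    \<open>t\<close>.\<close>
  define u where "u x = f x - be *\<^sub>C x" for x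
  have u_in: "u x \<in> M" if "x \<in> M" for x using that by (simp add: u_def f_in)
  have tu: "t * u x = u x * t" if x: "x \<in> M" for x
    using tf[OF x] by (simp add: u_def q scale_simps algebra_simps)
  have u_rel: "u (x * t) * z - u x * z * t + t * z * u x - z * u (x * t) = 0"
    if x: "x \<in> M" and z: "z \<in> M" for x z
  proof -
    have "u (x * t) * z - u x * z * t + t * z * u x - z * u (x * t)
      = z * (t * u x - u x * t) - ((q * (z * x) - z * x * q) - (t * z - z * t) * f x - z * (q * x - x * q)
      + x * (q * z - z * q) + (z * f (x * t) - f (x * t) * z) - (z * f x - f x * z) * t)"
      by (simp add: u_def q scale_simps algebra_simps)
    then show ?thesis using J[OF x z] tu[OF x] by simp
  qed
  have "\<exists>a b. u x = a *\<^sub>C 1 + b *\<^sub>C t" if x: "x \<in> M" for x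
  proof (rule dependent_if_commutator_identity[OF t _ _ _ _ s])
    show "u (x * t) * z - u x * z * t + t * z * u x + z * (- u (x * t)) = 0" if "z \<in> M" for z
      using u_rel[OF x that] by simp
  qed (use x t u_in in auto)
  then obtain a b where uab: "\<And>x. x \<in> M \<Longrightarrow> u x = a x *\<^sub>C 1 + b x *\<^sub>C t" by metis
  have a_eq: "a x = - b (x * t)" if x: "x \<in> M" for x
  proof -
    \<comment> \<open>Inserting the known form of \<open>u x\<close> into \<open>u_rel\<close>
      leaves exactly this commutation. The resulting scalar has no
      \<open>t\<close>-component.\<close>
    have "(u (x * t) + a x *\<^sub>C t) * z = z * (u (x * t) + a x *\<^sub>C t)" if z: "z \<in> M" for z
      using u_rel[OF x z] by (simp add: uab[OF x] scale_simps algebra_simps)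
    then obtain k where "u (x * t) + a x *\<^sub>C t = k *\<^sub>C 1"
      using central_scalar[of "u (x * t) + a x *\<^sub>C t"] u_in x t by auto
    then have "a (x * t) *\<^sub>C 1 + (b (x * t) + a x) *\<^sub>C t = k *\<^sub>C 1 + 0 *\<^sub>C t"
      using uab[of "x * t"] x t by (simp add: scale_simps algebra_simps)
    then show ?thesis using indep2 by (metis eq_neg_iff_add_eq_0 add.commute)
  qed
  \<comment> \<open>The sign is chosen so that \<open>f_h\<close> expresses \<open>f\<close> as the
    coboundary of \<open>h\<close> against \<open>t\<close>.\<close>
  define h where "h x = - b x" for x
  have ht: "h t = - be"
  proof -
    have "(al + al) *\<^sub>C 1 + (be + be) *\<^sub>C t = f t"
      by (simp only: ft q scaleC_add_left ac_simps)
    also have "\<dots> = a t *\<^sub>C 1 + (be + b t) *\<^sub>C t"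
      using uab[OF t] by (simp add: u_def scale_simps algebra_simps)
    finally have "(al + al) *\<^sub>C 1 + (be + be) *\<^sub>C t = a t *\<^sub>C 1 + (be + b t) *\<^sub>C t" .
    then show ?thesis using indep2 by (fastforce simp: h_def)
  qed
  have f_h: "f x = h (x * t) *\<^sub>C 1 - h x *\<^sub>C t - h t *\<^sub>C x" if x: "x \<in> M" for x
    using uab[OF x] a_eq[OF x] ht by (simp add: u_def h_def scale_simps algebra_simps)
  have h_add: "h (x + y) = h x + h y" if x: "x \<in> M" and y: "y \<in> M" for x y
  proof -
    have "f (x + y) = f x + f y" using F_add x y t by (simp add: f_def)
    then have "h ((x + y) * t) *\<^sub>C 1 + (- h (x + y)) *\<^sub>C t
      = (h (x * t) + h (y * t)) *\<^sub>C 1 + (- (h x + h y)) *\<^sub>C t"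
      using f_h[of "x + y"] f_h[OF x] f_h[OF y] x y by (simp add: scale_simps algebra_simps)
    then show ?thesis using indep2 by (metis neg_equal_iff_equal)
  qed
  have h_diff: "h (x - y) = h x - h y" if "x \<in> M" "y \<in> M" for x y
    using h_add[of "x - y" y] that by simp
  \<comment> \<open>The deviation of \<open>F\<close> from the coboundary of \<open>h\<close>;
    \<open>f_h\<close> says that it vanishes when the second argument is \<open>t\<close>.\<close>
  define P where "P x y = F x y - h (x * y) *\<^sub>C 1 + h x *\<^sub>C y + h y *\<^sub>C x" for x y
  have F_P: "F x y = P x y + h (x * y) *\<^sub>C 1 - h x *\<^sub>C y - h y *\<^sub>C x" for x y
    by (simp add: P_def)
  have tF: "t * F x y - F x y * t = - (h x *\<^sub>C (t * y - y * t)) - h y *\<^sub>C (t * x - x * t)"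
    if x: "x \<in> M" and y: "y \<in> M" for x y
    using cyc[OF x y t] F_sym[OF t x] f_h[OF x] f_h[OF y]
    by (simp add: f_def[symmetric] scale_simps algebra_simps)
  have P_rel: "P z x * (y * t - t * y) + P y x * (z * t - t * z) = 0"
    if x: "x \<in> M" and y: "y \<in> M" and z: "z \<in> M" for x y z
    using cyc_t[OF x y z] f_h[of "z * x"] f_h[of "y * x"] f_h[OF x] tF[OF y z] x y z
    by (simp add: F_P scale_simps algebra_simps)
  have P0: "P y x = 0" if x: "x \<in> M" and y: "y \<in> M" for x y
  proof (rule ccontr)
    assume nz: "P y x \<noteq> 0"
    have P_in: "P y x \<in> M" if "y \<in> M" for y using that x by (simp add: P_def F_in)
    have "\<exists>c d. t * t = c *\<^sub>C 1 + d *\<^sub>C t"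
    proof (rule right_dependent3)
      show "(P (y * t) x * t) * z * 1 + (- P (y * t) x - P y x * t) * z * t + P y x * z * (t * t) = 0"
        if z: "z \<in> M" for z
      proof -
        \<comment> \<open>The commutator of \<open>y * t\<close> with \<open>t\<close> is that of
          \<open>y\<close> with \<open>t\<close>, times \<open>t\<close>, so \<open>P z x\<close>
          cancels. If \<open>P y x \<noteq> 0\<close>, \<open>t * t\<close> would be a combination
          of \<open>1\<close> and \<open>t\<close>.\<close>
        have "(P (y * t) x * t) * z * 1 + (- P (y * t) x - P y x * t) * z * t + P y x * z * (t * t)
          = (P z x * (y * t - t * y) + P y x * (z * t - t * z)) * t
            - (P z x * ((y * t) * t - t * (y * t)) + P (y * t) x * (z * t - t * z))"
          by (simp add: algebra_simps)
        then show ?thesis using P_rel[OF x y z] P_rel[OF x _ z, of "y * t"] y t by simp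
      qed
    qed (use nz t P_in y in auto)
    then obtain c d where "t * t = c *\<^sub>C 1 + d *\<^sub>C t" by blast
    then have "(- c) *\<^sub>C 1 + (- d) *\<^sub>C t + 1 *\<^sub>C (t * t) = 0"
      by (simp add: scale_simps)
    then show False using indep by fastforce
  qed
  show ?thesis
  proof (rule that)
    fix x y assume x: "x \<in> M" and y: "y \<in> M"
    show "h (x + y) = h x + h y" using h_add x y .
    have "h (x * y) *\<^sub>C 1 + 0 *\<^sub>C t = h (y * x) *\<^sub>C 1 + 0 *\<^sub>C t"
      using F_sym[OF x y] P0[OF x y] P0[OF y x] by (simp add: F_P algebra_simps)
    then show "h (x * y - y * x) = 0" using indep2 h_diff x y by (metis diff_self mult_in)
    show "L (x * y) - h (x * y) *\<^sub>C 1 = (L x - h x *\<^sub>C 1) * y + x * (L y - h y *\<^sub>C 1)"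
      using P0[OF y x] by (simp add: P_def F_def scale_simps algebra_simps)
  qed
qed

end


section \<open>Generalized Lie derivations of factors\<close>

lemma factor_centrally_closed_prime_algebra:
  assumes "factor M"
  shows "centrally_closed_prime_algebra M"
proof
  show "\<exists>c. a = c *\<^sub>C 1" if "a \<in> M" "\<And>b. b \<in> M \<Longrightarrow> a * b = b * a" for a
    using factor_central_scalar[OF assms that] by blast
qed (use assms in \<open>auto intro: factor_closed factor_prime factor_extended_centroid
    simp: cop_mult_scaleC_left cop_mult_scaleC_right\<close>)

text \<open>For an integer polynomial \<open>p\<close> of least degree vanishing at
  \<open>x\<close>, applying \<open>e\<close> gives \<open>poly (pderiv p) x * e x = 0\<close>, and
  the first factor is nonzero by minimality.\<close>

lemma derivation_algebraic_eq_0: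
  fixes e :: "complex \<Rightarrow> complex"
  assumes add: "\<And>x y. e (x + y) = e x + e y" and mult: "\<And>x y. e (x * y) = e x * y + x * e y"
    and alg: "algebraic x"
  shows "e x = 0"
proof -
  have e0: "e 0 = 0" using add[of 0 0] by simp
  have e1: "e 1 = 0" using mult[of 1 1] by simp
  have e_nat: "e (of_nat n) = 0" for n by (induction n) (simp_all add: e0 e1 add)
  have e_minus: "e (- y) = - e y" for y
    using add[of y "- y"] e0 by (simp add: eq_neg_iff_add_eq_0 add.commute)
  have e_int: "e y = 0" if "y \<in> \<int>" for y
    using that
  proof (cases rule: Ints_cases)
    case (of_int z)
    then show ?thesis
      using e_nat[of "nat z"] e_nat[of "nat (- z)"] e_minus[of "of_nat (nat (- z))"]
      by (cases "z \<ge> 0") auto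
  qed
  have e_poly: "e (poly p x) = poly (pderiv p) x * e x" if "\<forall>i. coeff p i \<in> \<int>" for p
    using that
  proof (induction p)
    case 0
    then show ?case by (simp add: e0)
  next
    case (pCons c p)
    have "c \<in> \<int>" "\<forall>i. coeff p i \<in> \<int>"
      using pCons.prems by (metis coeff_pCons_0, metis coeff_pCons_Suc)
    then show ?case using pCons.IH by (simp add: add mult e_int pderiv_pCons algebra_simps)
  qed
  define Q where "Q p \<longleftrightarrow> (\<forall>i. coeff p i \<in> \<int>) \<and> p \<noteq> 0 \<and> poly p x = 0" for p
  have "\<exists>p. Q p" using alg by (auto simp: Q_def elim!: algebraicE)
  then obtain p where p: "Q p" and least: "\<And>r. Q r \<Longrightarrow> degree p \<le> degree r"
    using arg_min_nat_lemma[of Q _ degree] by blast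
  have deg: "degree p \<noteq> 0"
  proof
    assume "degree p = 0"
    then obtain c where "p = [:c:]" by (rule degree_eq_zeroE)
    then show False using p by (simp add: Q_def)
  qed
  have "poly (pderiv p) x \<noteq> 0"
  proof
    assume "poly (pderiv p) x = 0"
    moreover have "\<forall>i. coeff (pderiv p) i \<in> \<int>" using p by (auto simp: Q_def coeff_pderiv)
    moreover have "pderiv p \<noteq> 0" using deg by (simp add: pderiv_eq_0_iff)
    ultimately have "degree p \<le> degree (pderiv p)" by (intro least) (simp add: Q_def)
    then show False using deg by (simp add: degree_pderiv)
  qed
  moreover have "poly (pderiv p) x * e x = 0" using e_poly[of p] p e0 by (simp add: Q_def)
  ultimately show ?thesis by simp
qed

text \<open>The center consists of scalars, so a nontrivial relation between \<open>1\<close>,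
  \<open>t\<close> and \<open>t * t\<close> bounds the degree of \<open>t\<close> by 2. The
  hypothesis \<open>one\<close> keeps a nonzero leading scalar nonzero as an operator.\<close>

lemma degree_ge_3_independent:
  fixes M :: "'h::chilbert_space cop set"
  assumes "factor M" and "algebra_degree M \<ge> 3" and one: "(1 :: 'h cop) \<noteq> 0"
  obtains t where "t \<in> M"
    and "\<And>a b c. a *\<^sub>C 1 + b *\<^sub>C t + c *\<^sub>C (t * t) = 0 \<Longrightarrow> a = 0 \<and> b = 0 \<and> c = 0"
proof -
  have "\<exists>t\<in>M. \<not> alg_degree M t \<le> 2"
  proof (rule ccontr)
    assume "\<not> ?thesis"
    then have "algebra_degree M \<le> 2" unfolding algebra_degree_def by (auto intro: SUP_least)
    with assms(2) have "(3::enat) \<le> 2" by (rule order_trans)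
    then show False by (simp add: numeral_eq_enat)
  qed
  then obtain t where t: "t \<in> M" and deg: "\<not> alg_degree M t \<le> 2" by blast
  have no_rel: "(\<Sum>k\<le>n. (z k *\<^sub>C 1) * t ^ k) \<noteq> 0" if "z n \<noteq> 0" and "n \<le> 2" for z n
  proof
    assume sum0: "(\<Sum>k\<le>n. (z k *\<^sub>C 1) * t ^ k) = 0"
    have "z n *\<^sub>C 1 \<noteq> (0 :: 'h cop)" using that one scaleC_eq_0 by blast
    moreover have "z k *\<^sub>C 1 \<in> center M" for k
      using assms(1) by (simp add: factor_def scalar_operators_def)
    ultimately have "(\<forall>k\<le>n. z k *\<^sub>C 1 \<in> center M) \<and> z n *\<^sub>C 1 \<noteq> (0 :: 'h cop)
        \<and> (\<Sum>k\<le>n. (z k *\<^sub>C 1) * t ^ k) = 0"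
      using sum0 by blast
    then have "alg_degree M t \<le> enat n" unfolding alg_degree_def
      by (intro Inf_lower CollectI exI[of _ n] conjI[OF refl]) (rule exI[of _ "\<lambda>k. z k *\<^sub>C 1"])
    also have "\<dots> \<le> 2" using that by (simp add: numeral_eq_enat)
    finally show False using deg by simp
  qed
  show ?thesis
  proof (rule that[OF t])
    fix a b c assume rel: "a *\<^sub>C 1 + b *\<^sub>C t + c *\<^sub>C (t * t) = 0"
    define z where "z k = (if k = 0 then a else if k = 1 then b else c)" for k :: nat
    note sums = z_def eval_nat_numeral atMost_Suc cop_mult_scaleC_left add.commute add.left_commute
    have c: "c = 0"
      \<comment> \<open>The coefficients are eliminated from the top, as \<open>no_rel\<close>
        concerns the leading one.\<close>
      using no_rel[of z 2] rel by (auto simp: sums)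
    have b: "b = 0"
      using no_rel[of z 1] rel c by (auto simp: sums scaleC_zero_left)
    show "a = 0 \<and> b = 0 \<and> c = 0"
      using no_rel[of z 0] rel b c by (auto simp: sums scaleC_zero_left)
  qed
qed

text \<open>The condition on \<open>M\<close> and \<xi> in the last clause excludes scalar
  \<open>M\<close> with transcendental \<xi>. There an additive derivation \<open>d\<close> of the
  complex numbers with \<open>d \<xi> \<noteq> 0\<close> exists, and \<delta> = L with
  \<open>L z = d z + l * z\<close>, \<open>l = d \<xi> / (\<xi> - 1)\<close>, violates
  homogeneity.\<close>

theorem theorem3p2:
  fixes M :: "'h::chilbert_space cop set"
    and \<xi> :: complex
    and \<delta> :: "'h cop \<Rightarrow> 'h cop"
  assumes "factor M"
    and "\<xi> \<noteq> 0"
    and "additive_generalized_xi_Lie_derivation M \<xi> \<delta>"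
  shows "(\<xi> = 1 \<and> algebra_degree M \<ge> 3 \<longrightarrow>
           (\<exists>\<tau> h. additive_generalized_derivation M \<tau> \<and> additive_functional_on M h \<and>
              (\<forall>A\<in>M. \<forall>B\<in>M. h (A * B - B * A) = 0) \<and>
              (\<forall>A\<in>M. \<delta> A = \<tau> A + h A *\<^sub>C 1))) \<and>
         (\<xi> \<noteq> 1 \<longrightarrow>
           additive_generalized_derivation M \<delta> \<and>
           (M \<noteq> scalar_operators \<or> algebraic \<xi> \<longrightarrow>
              (\<forall>A\<in>M. \<delta> (\<xi> *\<^sub>C A) = \<xi> *\<^sub>C \<delta> A)))"
proof -
  interpret centrally_closed_prime_algebra M
    by (rule factor_centrally_closed_prime_algebra) fact
  obtain L where L: "additive_xi_Lie_derivation M \<xi> L"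
    and del_xi: "\<And>a b. a \<in> M \<Longrightarrow> b \<in> M \<Longrightarrow> \<delta> (a * b - \<xi> *\<^sub>C (b * a))
      = \<delta> a * b - \<xi> *\<^sub>C (\<delta> b * a) + a * L b - \<xi> *\<^sub>C (b * L a)"
    using assms(3) unfolding additive_generalized_xi_Lie_derivation_def xi_bracket_def by blast
  have del_in: "\<delta> a \<in> M" if "a \<in> M" for a
    using assms(3) that by (simp add: additive_generalized_xi_Lie_derivation_def additive_map_on_def)
  have del_add: "\<delta> (a + b) = \<delta> a + \<delta> b" if "a \<in> M" "b \<in> M" for a b
    using assms(3) that by (simp add: additive_generalized_xi_Lie_derivation_def additive_map_on_def)
  have L_in: "L a \<in> M" if "a \<in> M" for a
    using L that by (simp add: additive_xi_Lie_derivation_def additive_map_on_def)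
  have L_add: "L (a + b) = L a + L b" if "a \<in> M" "b \<in> M" for a b
    using L that by (simp add: additive_xi_Lie_derivation_def additive_map_on_def)
  have L_xi: "L (a * b - \<xi> *\<^sub>C (b * a))
      = (L a * b - \<xi> *\<^sub>C (b * L a)) + (a * L b - \<xi> *\<^sub>C (L b * a))"
    if "a \<in> M" "b \<in> M" for a b
    using L that by (simp add: additive_xi_Lie_derivation_def xi_bracket_def)
  define c where "c = \<delta> 1 - L 1"
  have c_in: "c \<in> M" by (simp add: c_def del_in L_in)
  \<comment> \<open>For \<xi> other than -1, the brackets of \<open>1\<close> and \<open>a\<close>
    in both orders coincide, and comparing the expansions of \<delta> - L gives
    \<open>1 + \<xi>\<close> times the claim. For -1 that factor is zero, but the bracket is
    \<open>a + a\<close> and additivity suffices.\<close>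
  have del: "\<delta> a = c * a + L a" if a: "a \<in> M" for a
  proof (cases "\<xi> = - 1")
    case True
    have "\<delta> a - (c * a + L a)
      = (\<delta> (1 * a - \<xi> *\<^sub>C (a * 1)) - L (1 * a - \<xi> *\<^sub>C (a * 1)))
        - (\<delta> 1 * a - \<xi> *\<^sub>C (\<delta> a * 1) + 1 * L a - \<xi> *\<^sub>C (a * L 1)
          - ((L 1 * a - \<xi> *\<^sub>C (a * L 1)) + (1 * L a - \<xi> *\<^sub>C (L a * 1))))"
      using True a by (simp add: scale_simps del_add L_add c_def algebra_simps)
    also have "\<dots> = 0" unfolding del_xi[OF one_in a] L_xi[OF one_in a] by simp
    finally show ?thesis by simp
  next
    case False
    have "(1 + \<xi>) *\<^sub>C (\<delta> a - (c * a + L a))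
      = (\<delta> a * 1 - \<xi> *\<^sub>C (\<delta> 1 * a) + a * L 1 - \<xi> *\<^sub>C (1 * L a)
          - ((L a * 1 - \<xi> *\<^sub>C (1 * L a)) + (a * L 1 - \<xi> *\<^sub>C (L 1 * a))))
        - (\<delta> 1 * a - \<xi> *\<^sub>C (\<delta> a * 1) + 1 * L a - \<xi> *\<^sub>C (a * L 1)
          - ((L 1 * a - \<xi> *\<^sub>C (a * L 1)) + (1 * L a - \<xi> *\<^sub>C (L a * 1))))"
      by (simp add: c_def scale_simps algebra_simps)
    also have "\<dots> = 0"
      unfolding del_xi[OF one_in a, symmetric] L_xi[OF one_in a, symmetric]
        del_xi[OF a one_in, symmetric] L_xi[OF a one_in, symmetric] by simp
    finally have "\<delta> a - (c * a + L a) = 0"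
      by (rule scaleC_eq_0) (use False in \<open>simp add: add_eq_0_iff\<close>)
    then show ?thesis by simp
  qed
  show ?thesis
  proof (intro conjI impI)
    assume xi: "\<xi> = 1 \<and> 3 \<le> algebra_degree M"
    show "\<exists>\<tau> h. additive_generalized_derivation M \<tau> \<and> additive_functional_on M h \<and>
      (\<forall>A\<in>M. \<forall>B\<in>M. h (A * B - B * A) = 0) \<and> (\<forall>A\<in>M. \<delta> A = \<tau> A + h A *\<^sub>C 1)"
    proof (cases "(1 :: 'h cop) = 0")
      \<comment> \<open>On the zero space there is no nonzero leading coefficient, so every degree
        is \<infinity> and the degree hypothesis holds although no independent \<open>t\<close>
        exists.\<close>
      case True
      then have triv: "A = 0" for A :: "'h cop" by (metis mult_1 mult_zero_left)
      have "additive_generalized_derivation M \<delta>"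
        unfolding additive_generalized_derivation_def additive_derivation_def additive_map_on_def
        using del_in del_add by (auto intro!: exI[of _ \<delta>]) (metis triv)+
      moreover have "additive_functional_on M (\<lambda>_. 0)" by (simp add: additive_functional_on_def)
      ultimately show ?thesis
        by (intro exI[of _ \<delta>] exI[of _ "\<lambda>_. 0"]) (simp add: scaleC_zero_left)
    next
      case False
      obtain t where t: "t \<in> M"
        and indep: "\<And>a b c. a *\<^sub>C 1 + b *\<^sub>C t + c *\<^sub>C (t * t) = 0 \<Longrightarrow> a = 0 \<and> b = 0 \<and> c = 0"
        using degree_ge_3_independent[OF assms(1) _ False] xi by metis
      have L_Lie: "L (a * b - b * a) = (L a * b - b * L a) + (a * L b - L b * a)"
        if "a \<in> M" "b \<in> M" for a b
        using L_xi[OF that] xi by (simp add: scaleC_one)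
      obtain h where
        h: "\<And>a b. a \<in> M \<Longrightarrow> b \<in> M \<Longrightarrow> h (a + b) = h a + h b"
          "\<And>a b. a \<in> M \<Longrightarrow> b \<in> M \<Longrightarrow> h (a * b - b * a) = 0"
          "\<And>a b. a \<in> M \<Longrightarrow> b \<in> M \<Longrightarrow>
            L (a * b) - h (a * b) *\<^sub>C 1 = (L a - h a *\<^sub>C 1) * b + a * (L b - h b *\<^sub>C 1)"
        by (rule Lie_derivation[OF L_in L_add L_Lie t indep], assumption+, rule that)
      define d where "d x = L x - h x *\<^sub>C 1" for x
      have d: "additive_derivation M d"
        using h by (auto simp: additive_derivation_def additive_map_on_def d_def L_in L_add
            scaleC_add_left)
      have "additive_generalized_derivation M (\<lambda>x. c * x + d x)"
        unfolding additive_generalized_derivation_def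
        using d c_in by (auto simp: additive_derivation_def additive_map_on_def algebra_simps
            intro!: exI[of _ d])
      moreover have "additive_functional_on M h" using h by (simp add: additive_functional_on_def)
      ultimately show ?thesis using h(2) del
        by (intro exI[of _ "\<lambda>x. c * x + d x"] exI[of _ h]) (simp add: d_def)
    qed
  next
    assume xi: "\<xi> \<noteq> 1"
    have main: "additive_generalized_derivation M \<delta> \<and>
        (M \<noteq> scalar_operators \<or> algebraic \<xi> \<longrightarrow> (\<forall>A\<in>M. \<delta> (\<xi> *\<^sub>C A) = \<xi> *\<^sub>C \<delta> A))"
    proof (cases "\<xi> = - 1")
      case True
      have L_der: "L (a * b) = L a * b + a * L b" if a: "a \<in> M" and b: "b \<in> M" for a b
      proof (rule jordan_derivation[OF L_in L_add _ a b])
        show "L (a * b + b * a) = L a * b + b * L a + a * L b + L b * a" if "a \<in> M" "b \<in> M" for a b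
          using L_xi[OF that] True by (simp add: scale_simps algebra_simps)
      qed
      have "additive_derivation M L"
        by (simp add: additive_derivation_def additive_map_on_def L_in L_add L_der)
      then have "additive_generalized_derivation M \<delta>"
        unfolding additive_generalized_derivation_def
        by (auto simp: additive_map_on_def c_in L_in L_add del L_der algebra_simps intro!: exI[of _ L])
      moreover have "\<delta> (\<xi> *\<^sub>C A) = \<xi> *\<^sub>C \<delta> A" if A: "A \<in> M" for A
      proof -
        have "\<delta> 0 = 0" using del_add[of 0 0] by simp
        then have "\<delta> (- A) = - \<delta> A"
          using del_add[of A "- A"] A by (simp add: eq_neg_iff_add_eq_0 add.commute)
        then show ?thesis using True by (simp add: scale_simps)
      qed
      ultimately show ?thesis by blast
    next
      case False
      obtain l where
        l: "\<And>a b. a \<in> M \<Longrightarrow> b \<in> M \<Longrightarrow> L (a * b) = L a * b + a * L b - l *\<^sub>C (a * b)"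
          "\<And>a. a \<in> M \<Longrightarrow> L (\<xi> *\<^sub>C a) = \<xi> *\<^sub>C L a - ((1 - \<xi>) * l) *\<^sub>C a"
          "\<And>a b. a \<in> M \<Longrightarrow> b \<in> M \<Longrightarrow> a * b \<noteq> b * a \<Longrightarrow> l = 0"
        by (rule xi_Lie_derivation[OF L_in L_add L_xi xi False], assumption+, rule that)
      define d where "d x = L x - l *\<^sub>C x" for x
      have d_in: "d x \<in> M" if "x \<in> M" for x using that by (simp add: d_def L_in)
      have d_add: "d (x + y) = d x + d y" if "x \<in> M" "y \<in> M" for x y
        using that by (simp add: d_def L_add scaleC_add_right)
      have d_mult: "d (x * y) = d x * y + x * d y" if "x \<in> M" "y \<in> M" for x y
        using that by (simp add: d_def l scale_simps algebra_simps)
      have "additive_derivation M d"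
        by (simp add: additive_derivation_def additive_map_on_def d_in d_add d_mult)
      moreover have "\<delta> (x * y) = \<delta> x * y + x * d y" if "x \<in> M" "y \<in> M" for x y
        using that by (simp add: del l d_def scale_simps algebra_simps)
      ultimately have "additive_generalized_derivation M \<delta>"
        unfolding additive_generalized_derivation_def additive_map_on_def
        using del_in del_add by blast
      moreover have "\<delta> (\<xi> *\<^sub>C A) = \<xi> *\<^sub>C \<delta> A"
        if hyp: "M \<noteq> scalar_operators \<or> algebraic \<xi>" and A: "A \<in> M" for A
      proof -
        \<comment> \<open>The failure of homogeneity is
          \<open>(1 - \<xi>) *\<^sub>C l *\<^sub>C A\<close>, so only this product matters.\<close>
        have l0: "l *\<^sub>C A = 0"
        proof (cases "\<exists>a\<in>M. \<exists>b\<in>M. a * b \<noteq> b * a")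
          case True
          then show ?thesis using l(3) by (auto simp: scaleC_zero_left)
        next
          case comm: False
          have "M = scalar_operators"
          proof
            show "M \<subseteq> scalar_operators"
              using comm central_scalar by (fastforce simp: scalar_operators_def)
            show "scalar_operators \<subseteq> M" by (auto simp: scalar_operators_def)
          qed
          then have alg: "algebraic \<xi>" using hyp by blast
          show ?thesis
          proof (cases "(1 :: 'h cop) = 0")
            case True
            then show ?thesis by (metis mult_1 mult_zero_left)
          next
            case one: False
            \<comment> \<open>On scalars \<open>d\<close> is an additive derivation \<open>e\<close>
              of the complex numbers, which kills the algebraic \<xi>. Comparing with the scaling
              rule for \<open>L\<close> then forces \<open>l = 0\<close>.\<close>
            have "\<forall>z. \<exists>e. d (z *\<^sub>C 1) = e *\<^sub>C 1"
              using d_in \<open>M = scalar_operators\<close> by (auto simp: scalar_operators_def)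
            then obtain e where e: "\<And>z. d (z *\<^sub>C 1) = e z *\<^sub>C 1" by metis
            have inj: "x = y" if "x *\<^sub>C 1 = y *\<^sub>C (1 :: 'h cop)" for x y
              using scaleC_eq_0[of "x - y" "1 :: 'h cop"] that one by (auto simp: scaleC_diff_left)
            have "e \<xi> = 0"
            proof (rule derivation_algebraic_eq_0[OF _ _ alg])
              show "e (x + y) = e x + e y" for x y
                using d_add[of "x *\<^sub>C 1" "y *\<^sub>C 1"]
                by (intro inj) (simp add: e scaleC_add_left[symmetric])
              show "e (x * y) = e x * y + x * e y" for x y
                using d_mult[of "x *\<^sub>C 1" "y *\<^sub>C 1"]
                by (intro inj) (simp add: e mult_scaleC_left mult_scaleC_right scaleC_scaleC
                    scaleC_add_left mult.commute)
            qed
            then have "L (\<xi> *\<^sub>C 1) = l *\<^sub>C \<xi> *\<^sub>C 1"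
              using e[of \<xi>] by (simp add: d_def scaleC_zero_left)
            moreover have "L 1 = l *\<^sub>C 1" using l(1)[of 1 1] by (simp add: algebra_simps)
            ultimately have "((1 - \<xi>) * l) *\<^sub>C (1 :: 'h cop) = 0 *\<^sub>C 1"
              using l(2)[of 1] by (simp add: scaleC_scaleC scaleC_zero_left mult.commute)
            then have "l = 0" using inj xi by fastforce
            then show ?thesis by (simp add: scaleC_zero_left)
          qed
        qed
        have "\<delta> (\<xi> *\<^sub>C A) = \<xi> *\<^sub>C \<delta> A - (1 - \<xi>) *\<^sub>C l *\<^sub>C A"
          using A by (simp add: del l scale_simps algebra_simps)
        then show ?thesis using l0 by (simp add: scaleC_zero_right)
      qed
      ultimately show ?thesis by blast
    qed
    show "additive_generalized_derivation M \<delta>" using main by blast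
    show "\<forall>A\<in>M. \<delta> (\<xi> *\<^sub>C A) = \<xi> *\<^sub>C \<delta> A" if "M \<noteq> scalar_operators \<or> algebraic \<xi>"
      using main that by blast
  qed
qed

end
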